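(* Let $p$ be an odd prime. If $\sigma\in GL_2(\mathbb{F}_p)$ has an eigenvalue equal to $1$, and $\mathcal{P}$ is a partition expressible in the form $$\mathcal{P}=\bigl(le,\ nf,\ (\pi_1d'')^{[m_1d']},\ (\pi_2d'')^{[m_2d']},\dots,(\pi_ud'')^{[m_ud']}\bigr),$$ feasible for tiling by $\sigma$-orbits, then $$|\mathrm{Fix}_{\mathcal{P}}(\sigma)|=\begin{cases} O(\sigma,\mathcal{P})\displaystyle\binom{n+\frac{p-1}{f}-1}{n}\,W_{(l,\,\pi_1^{[m_1]},\,\dots,\,\pi_u^{[m_u]})} & \text{if }\sigma\in{}_pH^1_f(f,1),\\[10pt] \displaystyle\binom{\pi_1+p-2}{\pi_1}\,W_{(l)} & \text{if }\sigma\in{}_pP^1(p,1),\end{cases}$$ where $$O(\sigma,\mathcal{P})=\frac{o(\sigma)!}{(o(\sigma)-u)!\;m_1!\,m_2!\cdots m_u!}.$$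
   Context: Zero-sum multisets. Let $V_2(\mathbb{F}_p)$ be the space of columns of length $2$ over the field $\mathbb{F}_p$ with $p$ elements. A zero-sum multiset is a multiset $M$ of $R\ge 3$ non-zero vectors of $V_2(\mathbb{F}_p)$ whose sum (with multiplicity) is $0$ and which spans $V_2(\mathbb{F}_p)$. For each of the $p+1$ one-dimensional subspaces $L$ of $V_2(\mathbb{F}_p)$, let $\mu_L\ge 0$ be the number of elements of $M$ (with multiplicity) lying in $L$; the partition type of $M$ is the partition of $R$ whose parts are the non-zero $\mu_L$. For a partition $\mathcal{P}$, $\mathcal{M}(\mathcal{P})$ is the collection of zero-sum multisets of partition type $\mathcal{P}$. $GL_2(\mathbb{F}_p)$ acts on multisets elementwise by left multiplication, and $\mathrm{Fix}_{\mathcal{P}}(\sigma)=\{M\in\mathcal{M}(\mathcal{P}) : \sigma M=M\}$. The notation $a^{[k]}$ means the entry $a$ repeated $k$ times. Class types. The central indicator $d'$ of $\sigma$ is the smallest positive integer such that $\sigma^{d'}$ is central (a scalar matrix); if $d$ is the order of $\sigma$, the central quotient is $d''=d/d'$. A non-central element is parabolic or hyperbolic if it has, respectively, one or two (one-dimensional) eigenspaces in $V_2(\mathbb{F}_p)$. ${}_pH^1_f(f,1)$ is the set of hyperbolic elements whose eigenvalues have multiplicative orders $1$ and $f>1$, with central indicator $f$ and central quotient $1$ (conjugates of $\mathrm{diag}(1,y)$ with $y\in\mathbb{F}_p^*$ of order $f$). ${}_pP^1(p,1)$ is the set of parabolic elements whose eigenvalue is $1$, with central indicator $p$ and central quotient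 $1$ (conjugates of $\begin{bmatrix}1&1\\0&1\end{bmatrix}$). A non-identity $\sigma$ with an eigenvalue equal to $1$ belongs to one of these sets. In the expression for $\mathcal{P}$, $d'$ and $d''$ are the central indicator and central quotient of $\sigma$, $e$ is the order of the eigenvalue $1$ (so $e=1$ and $d''=1$), and $f$ is the order of the other eigenvalue in the hyperbolic case. Put $o(\sigma)=\frac{p-1}{d'}=\frac{p-1}{f}$ if $\sigma\in{}_pH^1_f(f,1)$ and $o(\sigma)=1$ if $\sigma\in{}_pP^1(p,1)$. Feasibility. In the expression for $\mathcal{P}$, $l,n,u\ge 0$ and $\pi_i,m_i\ge 1$ are integers, and one or both of the first two parts ($le$, $nf$) may be $0$, or possibly equal to one or two of the other parts. A partition so expressible is feasible for tiling by $\sigma$-orbits, for $\sigma$ in one of the two class types above, if $\sigma$ has central indicator $d'$ and central quotient $d''$, $u\le o(\sigma)$, and: if $\sigma$ is parabolic, $n=0$, $u=m_1=1$ and $l\ne 1$; if $\sigma$ is hyperbolic and $u=0$, then $l,n>0$ and $l\neq 1$. The numbers $W$. For a tuple $\mathcal{Q}=(\mu_1,\dots,\mu_k)$ of integers put $B_{\mathcal{Q}}=\prod_{i=1}^k\binom{\mu_i+p-2}{\mu_i}$ and let $t\ge 0$ be the number of $i$ with $\mu_i\equiv1\pmod p$. Then $W_{\mathcal{Q}}=B_{\mathcal{Q}}/p$ if some $\mu_i\not\equiv0,1\pmod p$, and $W_{\mathcal{Q}}=\frac{B_{\mathcal{Q}}+(-1)^{t+1}}{p}+(-1)^t$ otherwise.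 The entries are positive, except that $l$ may be $0$, in which case the same formula is used.
   Formalization: In u ≤ o(σ) and (o(σ)−u)!, u is read as m_1+…+m_u, with the π_i distinct; in the hyperbolic case |Fix_P(σ)| is the sum of the formula over all feasible expressions of P, hence the single formula when the expression is unique. As worded the claim fails (e.g. p=3, σ=diag(1,2), P=(2,2)). *)

theory Defs
  imports "HOL-Analysis.Analysis" "HOL-Library.Multiset"
begin

text \<open>
  The field with \<open>p\<close> elements is rendered as an arbitrary finite field type \<open>'a\<close> with
  \<open>CARD('a) = p\<close> prime, and the space of columns of length 2 over it as \<open>'a^2\<close>.
\<close>

section \<open>Zero-sum multisets and their partition types\<close>

definition zero_sum_multiset :: "(('a::{field,finite})^2) multiset \<Rightarrow> bool" where
  "zero_sum_multiset M \<longleftrightarrow>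
     size M \<ge> 3 \<and> 0 \<notin># M \<and> sum_mset M = 0 \<and> vec.span (set_mset M) = UNIV"

definition lines :: "(('a::{field,finite})^2) set set" where
  "lines = {L. vec.subspace L \<and> vec.dim L = 1}"

definition partition_type :: "(('a::{field,finite})^2) multiset \<Rightarrow> nat multiset" where
  "partition_type M =
     filter_mset (\<lambda>k. k \<noteq> 0)
       (image_mset (\<lambda>L. size (filter_mset (\<lambda>v. v \<in> L) M)) (mset_set lines))"

definition multisets_of_type :: "nat multiset \<Rightarrow> (('a::{field,finite})^2) multiset set" where
  "multisets_of_type P = {M. zero_sum_multiset M \<and> partition_type M = P}"

definition Fix :: "nat multiset \<Rightarrow> ('a::{field,finite})^2^2 \<Rightarrow> ('a^2) multiset set" where
  "Fix P \<sigma> = {M \<in> multisets_of_type P. image_mset (\<lambda>v. \<sigma> *v v) M = M}"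


section \<open>Class types\<close>

definition eigenspace :: "('a::field)^2^2 \<Rightarrow> 'a \<Rightarrow> ('a^2) set" where
  "eigenspace \<sigma> c = {v. \<sigma> *v v = c *s v}"

definition eigenvalue :: "('a::field)^2^2 \<Rightarrow> 'a \<Rightarrow> bool" where
  "eigenvalue \<sigma> c \<longleftrightarrow> (\<exists>v. v \<noteq> 0 \<and> v \<in> eigenspace \<sigma> c)"

text \<open>
  Matrix powers are introduced explicitly, since the type class power on \<open>'a^2^2\<close> comes from
  the componentwise product.
\<close>

definition matpow :: "('a::field)^2^2 \<Rightarrow> nat \<Rightarrow> 'a^2^2" where
  "matpow \<sigma> k = (((**) \<sigma>) ^^ k) (mat 1)"

definition is_scalar :: "('a::field)^2^2 \<Rightarrow> bool" where
  "is_scalar \<sigma> \<longleftrightarrow> (\<exists>c. \<sigma> = mat c)"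

definition matrix_order :: "('a::field)^2^2 \<Rightarrow> nat" where
  "matrix_order \<sigma> = (LEAST k. k > 0 \<and> matpow \<sigma> k = mat 1)"

definition central_indicator :: "('a::field)^2^2 \<Rightarrow> nat" where
  "central_indicator \<sigma> = (LEAST k. k > 0 \<and> is_scalar (matpow \<sigma> k))"

definition central_quotient :: "('a::field)^2^2 \<Rightarrow> nat" where
  "central_quotient \<sigma> = matrix_order \<sigma> div central_indicator \<sigma>"

definition mult_order :: "'a::field \<Rightarrow> nat" where
  "mult_order c = (LEAST k. k > 0 \<and> c ^ k = 1)"

definition eigenlines :: "('a::{field,finite})^2^2 \<Rightarrow> ('a^2) set set" where
  "eigenlines \<sigma> = {L \<in> lines. \<exists>c. L = eigenspace \<sigma> c}"

definition parabolic :: "('a::{field,finite})^2^2 \<Rightarrow> bool" where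
  "parabolic \<sigma> \<longleftrightarrow> \<not> is_scalar \<sigma> \<and> card (eigenlines \<sigma>) = 1"

definition hyperbolic :: "('a::{field,finite})^2^2 \<Rightarrow> bool" where
  "hyperbolic \<sigma> \<longleftrightarrow> \<not> is_scalar \<sigma> \<and> card (eigenlines \<sigma>) = 2"

text \<open>The class type \<open>\<^sub>pH\<^sup>1\<^sub>f(f,1)\<close>, with \<open>p = CARD('a)\<close>.\<close>

definition hyperbolic_class :: "nat \<Rightarrow> (('a::{field,finite})^2^2) set" where
  "hyperbolic_class f =
     {\<sigma>. invertible \<sigma> \<and> hyperbolic \<sigma> \<and> f > 1 \<and>
         (\<exists>y. {c. eigenvalue \<sigma> c} = {1, y} \<and> mult_order y = f) \<and>
         central_indicator \<sigma> = f \<and> central_quotient \<sigma> = 1}"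

text \<open>The class type \<open>\<^sub>pP\<^sup>1(p,1)\<close>, with \<open>p = CARD('a)\<close>.\<close>

definition parabolic_class :: "(('a::{field,finite})^2^2) set" where
  "parabolic_class =
     {\<sigma>. invertible \<sigma> \<and> parabolic \<sigma> \<and> {c. eigenvalue \<sigma> c} = {1} \<and>
         central_indicator \<sigma> = CARD('a) \<and> central_quotient \<sigma> = 1}"

text \<open>
  The order \<open>f\<close> of the eigenvalue other than 1. It is meaningful only for hyperbolic elements;
  for parabolic ones it is only ever multiplied by \<open>n = 0\<close>.
\<close>

definition other_order :: "('a::{field,finite})^2^2 \<Rightarrow> nat" where
  "other_order \<sigma> = mult_order (THE c. eigenvalue \<sigma> c \<and> c \<noteq> 1)"

definition o_num :: "('a::{field,finite})^2^2 \<Rightarrow> nat" where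
  "o_num \<sigma> = (if hyperbolic \<sigma> then (CARD('a) - 1) div central_indicator \<sigma> else 1)"


section \<open>Feasible expressions of a partition\<close>

text \<open>
  An expression is a triple \<open>(l, n, B)\<close>, where the multiset \<open>B\<close> stands for
  \<open>\<pi>\<^sub>1\<^bsup>[m\<^sub>1]\<^esup>, \<dots>, \<pi>\<^sub>u\<^bsup>[m\<^sub>u]\<^esup>\<close> with distinct \<open>\<pi>\<^sub>i\<close>. This makes expressions independent of the order in
  which the \<open>\<pi>\<^sub>i\<close> are listed. Each element of \<open>B\<close> corresponds to one \<open>\<sigma>\<close>-orbit of lines that are
  not eigenspaces, and the bound \<open>u \<le> o(\<sigma>)\<close> and the factorial of \<open>o(\<sigma>) - u\<close> refer to the number
  of these orbits, so there \<open>u\<close> is \<open>size B = m\<^sub>1 + \<dots> + m\<^sub>u\<close>, each \<open>\<pi>\<^sub>i\<close> being counted \<open>m\<^sub>i\<close> times.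
\<close>

definition blocks :: "nat \<Rightarrow> (nat \<Rightarrow> nat) \<Rightarrow> (nat \<Rightarrow> nat) \<Rightarrow> nat multiset" where
  "blocks u \<pi> m = (\<Sum>i\<in>{1..u}. replicate_mset (m i) (\<pi> i))"

definition expr_partition ::
  "('a::{field,finite})^2^2 \<Rightarrow> nat \<times> nat \<times> nat multiset \<Rightarrow> nat multiset" where
  "expr_partition \<sigma> = (\<lambda>(l, n, B).
     filter_mset (\<lambda>k. k \<noteq> 0)
       ({# l * mult_order (1::'a), n * other_order \<sigma> #} +
        repeat_mset (central_indicator \<sigma>) (image_mset (\<lambda>q. q * central_quotient \<sigma>) B)))"

definition feasible ::
  "('a::{field,finite})^2^2 \<Rightarrow> nat \<times> nat \<times> nat multiset \<Rightarrow> bool" where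
  "feasible \<sigma> = (\<lambda>(l, n, B).
     (\<sigma> \<in> parabolic_class \<or> (\<exists>f. \<sigma> \<in> hyperbolic_class f)) \<and>
     0 \<notin># B \<and> size B \<le> o_num \<sigma> \<and>
     (parabolic \<sigma> \<longrightarrow> n = 0 \<and> size B = 1 \<and> l \<noteq> 1) \<and>
     (hyperbolic \<sigma> \<and> B = {#} \<longrightarrow> l > 0 \<and> n > 0 \<and> l \<noteq> 1))"

definition feasible_expressions ::
  "('a::{field,finite})^2^2 \<Rightarrow> nat multiset \<Rightarrow> (nat \<times> nat \<times> nat multiset) set" where
  "feasible_expressions \<sigma> P = {E. feasible \<sigma> E \<and> expr_partition \<sigma> E = P}"


section \<open>The counting formula\<close>

definition B_num :: "nat \<Rightarrow> nat multiset \<Rightarrow> nat" where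
  "B_num p Q = (\<Prod>\<mu>\<in>#Q. (\<mu> + p - 2) choose \<mu>)"

definition t_num :: "nat \<Rightarrow> nat multiset \<Rightarrow> nat" where
  "t_num p Q = size (filter_mset (\<lambda>\<mu>. \<mu> mod p = 1) Q)"

definition W_num :: "nat \<Rightarrow> nat multiset \<Rightarrow> real" where
  "W_num p Q =
     (if \<exists>\<mu>\<in>#Q. \<mu> mod p \<noteq> 0 \<and> \<mu> mod p \<noteq> 1 then real (B_num p Q) / real p
      else (real (B_num p Q) + (-1) ^ (t_num p Q + 1)) / real p + (-1) ^ t_num p Q)"

definition O_num :: "('a::{field,finite})^2^2 \<Rightarrow> nat multiset \<Rightarrow> real" where
  "O_num \<sigma> B =
     fact (o_num \<sigma>) / (fact (o_num \<sigma> - size B) * (\<Prod>q\<in>set_mset B. fact (count B q)))"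

definition hyperbolic_count ::
  "('a::{field,finite})^2^2 \<Rightarrow> nat \<Rightarrow> nat \<times> nat \<times> nat multiset \<Rightarrow> real" where
  "hyperbolic_count \<sigma> f = (\<lambda>(l, n, B).
     O_num \<sigma> B * real ((n + (CARD('a) - 1) div f - 1) choose n) *
     W_num (CARD('a)) (add_mset l B))"

end

theory Submission
  imports Defs "HOL-Combinatorics.Multiset_Permutations"
    "HOL-Computational_Algebra.Polynomial_FPS" "HOL-Number_Theory.Cong"
begin

text \<open>
  In a basis adapted to \<open>\<sigma>\<close> the non-zero vectors fall into explicit \<open>\<sigma>\<close>-orbits, and a multiset is fixed
  by \<open>\<sigma>\<close> iff it is a union of orbits. For \<open>\<sigma> = diag(1, y)\<close> the orbits off the \<open>y\<close>-eigenline are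
  labelled by a \<open>\<langle>\<sigma>\<rangle>\<close>-orbit of lines and a first coordinate \<open>a \<noteq> 0\<close>; such an orbit sums to \<open>a\<close> or
  \<open>f a\<close> times the eigenvector with eigenvalue 1, whereas the orbits on the \<open>y\<close>-eigenline sum to 0. For
  parabolic \<open>\<sigma>\<close> all orbits off the eigenline sum to 0. So a fixed multiset has sum zero iff one linear
  equation over the field holds for the labels, and averaging over additive characters counts the
  solutions: a non-trivial character contributes a product of coefficients of
  \<open>(1 - X) / (1 - X\<^sup>p)\<close>, which gives the numbers \<open>W\<close>. Finally, \<open>O(\<sigma>, P)\<close> counts the ways to distribute
  the \<open>\<pi>\<^sub>i\<close> over the orbits of lines.
\<close>

section \<open>Sums over multisets of given size\<close>

text \<open>A partition can have several feasible expressions: \<open>(f * a, b, B)\<close> and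
  \<open>(f * b, a, B)\<close> give the same parts. A fixed multiset nevertheless realises only one
  of them, because its loads on the two eigenlines and on the orbits of lines are determined. The
  hyperbolic count is therefore made expression by expression and then summed. Two facts shape the
  formula. Since \<open>f\<close> is at most \<open>p - 1\<close>, it is invertible in the field, so
  every orbit off the \<open>y\<close>-eigenline really enters the linear equation; the orbits on
  that eigenline are unconstrained and give the separate binomial coefficient. Further, the size and
  spanning conditions depend on the partition type alone, and for solutions of the equation they
  amount to feasibility. In the parabolic case the vanishing of orbit sums rests on
  \<open>0 + 1 + ... + (p - 1) = 0\<close> in the field, which is where \<open>p\<close> has to be
  odd.\<close>

definition hsum :: "nat \<Rightarrow> 'b set \<Rightarrow> ('b \<Rightarrow> 'c) \<Rightarrow> 'c::comm_ring_1" where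
  "hsum n A g = (\<Sum>N\<in>multisets_of_size A n. \<Prod>x\<in>#N. g x)"

lemma hsum_0 [simp]: "hsum 0 A g = 1"
  by (simp add: hsum_def)

text \<open>\<open>hsum n A g\<close> is the complete homogeneous symmetric polynomial of degree
  \<open>n\<close> in the values of \<open>g\<close>. A multiset either avoids \<open>a\<close> or
  loses one copy of it.\<close>

lemma hsum_insert:
  assumes "finite A" "a \<notin> A"
  shows "hsum (Suc n) (insert a A) g = hsum (Suc n) A g + g a * hsum n (insert a A) g"
proof -
  have eq: "multisets_of_size (insert a A) (Suc n) =
      multisets_of_size A (Suc n) \<union> add_mset a ` multisets_of_size (insert a A) n"
    (is "?L = ?R1 \<union> ?R2")
  proof (intro equalityI subsetI)
    fix N assume N: "N \<in> ?L"
    show "N \<in> ?R1 \<union> ?R2"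
    proof (cases "a \<in># N")
      case True
      then obtain N' where "N = add_mset a N'" by (metis insert_DiffM)
      with N show ?thesis by (auto simp: multisets_of_size_def)
    qed (use N in \<open>auto simp: multisets_of_size_def\<close>)
  qed (auto simp: multisets_of_size_def)
  have "hsum (Suc n) (insert a A) g =
      (\<Sum>N\<in>?R1. \<Prod>x\<in>#N. g x) + (\<Sum>N\<in>?R2. \<Prod>x\<in>#N. g x)"
    unfolding hsum_def eq
    using assms by (intro sum.union_disjoint finite_imageI finite_multisets_of_size)
      (auto simp: multisets_of_size_def)
  also have "(\<Sum>N\<in>?R2. \<Prod>x\<in>#N. g x) = g a * hsum n (insert a A) g"
    by (simp add: sum.reindex inj_on_def hsum_def sum_distrib_left)
  finally show ?thesis by (simp add: hsum_def)
qed

text \<open>By \<open>hsum_insert\<close>, adjoining \<open>a\<close> to the set divides the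
  generating function by \<open>1 - g a * X\<close>. The identity is kept in product form, so that
  no inverse of a power series occurs.\<close>

lemma fps_hsum:
  fixes g :: "'b \<Rightarrow> 'c::comm_ring_1"
  assumes "finite A"
  shows "Abs_fps (\<lambda>n. hsum n A g) * (\<Prod>a\<in>A. 1 - fps_const (g a) * fps_X) = 1"
  using assms
proof (induction A rule: finite_induct)
  case empty
  have "hsum n {} g = (if n = 0 then 1 else 0)" for n
    by (simp add: hsum_def)
  then show ?case by (simp add: fps_eq_iff)
next
  case (insert a A)
  have "Abs_fps (\<lambda>n. hsum n (insert a A) g) * (1 - fps_const (g a) * fps_X) =
      Abs_fps (\<lambda>n. hsum n A g)" (is "?F * _ = ?G")
  proof (rule fps_ext)
    fix n
    have "fps_nth (?F * (1 - fps_const (g a) * fps_X)) n = fps_nth ?F n - fps_nth (fps_X * (fps_const (g a) * ?F)) n"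
      by (simp add: algebra_simps)
    also have "\<dots> = fps_nth ?G n"
      using insert.hyps by (cases n) (simp_all add: hsum_insert)
    finally show "fps_nth (?F * (1 - fps_const (g a) * fps_X)) n = fps_nth ?G n" .
  qed
  then show ?case
    using insert by (simp add: mult.assoc[symmetric])
qed

section \<open>Additive characters of a prime field\<close>

text \<open>Translation by 1 permutes the field; comparing the two sums shows that the
  characteristic divides the prime \<open>CARD('a)\<close>.\<close>

lemma CHAR_prime_card:
  assumes "prime (CARD('a))"
  shows "CHAR('a::{field,finite}) = CARD('a)"
proof -
  have "(\<Sum>x::'a\<in>UNIV. x + 1) = (\<Sum>x\<in>UNIV. x)"
    by (rule sum.reindex_bij_witness[of _ "\<lambda>x. x - 1" "\<lambda>x. x + 1"]) auto
  then have "of_nat CARD('a) = (0::'a)"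
    by (simp add: sum.distrib)
  then have "CHAR('a) dvd CARD('a)"
    by (simp add: of_nat_eq_0_iff_char_dvd)
  moreover have "CHAR('a) \<noteq> 1" by simp
  ultimately show ?thesis
    using assms by (metis prime_nat_iff)
qed

lemma bij_of_nat_prime_field:
  assumes "prime (CARD('a))"
  shows "bij_betw (of_nat :: nat \<Rightarrow> 'a::{field,finite}) {..<CARD('a)} UNIV"
proof -
  have "inj_on (of_nat :: nat \<Rightarrow> 'a) {..<CARD('a)}"
    using CHAR_prime_card[OF assms]
    by (auto simp: inj_on_def of_nat_eq_iff_cong_CHAR cong_def)
  moreover have "card ((of_nat :: nat \<Rightarrow> 'a) ` {..<CARD('a)}) = CARD('a)"
    using calculation by (simp add: card_image)
  ultimately show ?thesis
    by (auto simp: bij_betw_def card_subset_eq)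
qed

text \<open>The character is \<open>x \<mapsto> \<omega> ^ k\<close>, with \<open>\<omega>\<close> a
  primitive \<open>p\<close>-th root of unity and \<open>k < p\<close> the natural number that
  represents \<open>x\<close>. Being a bijection onto the roots of unity, it turns sums and products
  over the field into sums and products over all these roots.\<close>

lemma additive_character_exists:
  assumes p: "prime (CARD('a))"
  obtains \<psi> :: "'a::{field,finite} \<Rightarrow> complex" where
    "\<And>x y. \<psi> (x + y) = \<psi> x * \<psi> y" "bij_betw \<psi> UNIV {z. z ^ CARD('a) = 1}"
proof -
  let ?p = "CARD('a)"
  define \<omega> where "\<omega> = cis (2 * pi / ?p)"
  have pow: "\<omega> ^ k = cis (2 * pi * real k / ?p)" for k
    by (simp add: \<omega>_def Complex.DeMoivre mult_ac)
  have "\<omega> ^ ?p = 1"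
    by (simp add: pow)
  then have pow_mod: "\<omega> ^ (k mod ?p) = \<omega> ^ k" for k
    by (metis mult.right_neutral mod_mult_div_eq power_add power_mult power_one)
  have bij: "bij_betw (\<lambda>k. \<omega> ^ k) {..<?p} {z. z ^ ?p = 1}"
    using Complex.bij_betw_roots_unity[of ?p] by (simp add: pow)
  define idx where "idx = the_inv_into {..<?p} (of_nat :: nat \<Rightarrow> 'a)"
  have bidx: "bij_betw idx UNIV {..<?p}"
    unfolding idx_def by (rule bij_betw_the_inv_into[OF bij_of_nat_prime_field[OF p]])
  have idx: "of_nat (idx x) = x" for x
    unfolding idx_def using bij_of_nat_prime_field[OF p] f_the_inv_into_f_bij_betw by fastforce
  have idx_less: "idx x < ?p" for x
    using bidx by (auto simp: bij_betw_def)
  show ?thesis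
  proof
    fix x y :: 'a
    have "of_nat (idx (x + y)) = (of_nat (idx x + idx y) :: 'a)"
      by (simp add: idx)
    then have "idx (x + y) mod ?p = (idx x + idx y) mod ?p"
      using CHAR_prime_card[OF p] by (simp add: of_nat_eq_iff_cong_CHAR cong_def del: of_nat_add)
    then show "\<omega> ^ idx (x + y) = \<omega> ^ idx x * \<omega> ^ idx y"
      by (metis pow_mod power_add)
  next
    show "bij_betw (\<lambda>x. \<omega> ^ idx x) UNIV {z. z ^ ?p = 1}"
      using bij_betw_trans[OF bidx bij] by (simp add: o_def)
  qed
qed

text \<open>Both sides have degree at most \<open>n\<close> and agree at \<open>n + 1\<close>
  points, namely 0 and the roots of unity. The factors are written as \<open>1 - z * X\<close> to
  match the denominators in \<open>fps_hsum\<close>.\<close>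

lemma prod_roots_unity:
  assumes "n > 0"
  shows "(\<Prod>z\<in>{z::complex. z ^ n = 1}. [:1, -z:]) = 1 - monom 1 n"
proof -
  let ?U = "{z::complex. z ^ n = 1}"
  have fin: "finite ?U" using assms by (intro finite_roots_unity) simp
  have cU: "card ?U = n" by (rule card_roots_unity_eq[OF assms])
  have "0 \<notin> ?U" using assms by (simp add: power_0_left)
  show ?thesis
  proof (rule poly_eqI_degree[of "insert 0 ?U"])
    fix x assume "x \<in> insert 0 ?U"
    then consider "x = 0" | "x \<in> ?U" by auto
    then show "poly (\<Prod>z\<in>?U. [:1, -z:]) x = poly (1 - monom 1 n) x"
    proof cases
      case 2
      then have x0: "x \<noteq> 0" using \<open>0 \<notin> ?U\<close> by auto
      \<comment> \<open>The factor that vanishes at a root of unity \<open>x\<close> is the one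
        belonging to its inverse.\<close>
      have "inverse x \<in> ?U" using 2 by (simp add: power_inverse)
      moreover have "poly [:1, - inverse x:] x = 0" using x0 by simp
      ultimately have "(\<Prod>z\<in>?U. poly [:1, -z:] x) = 0"
        using fin by (metis (no_types, lifting) prod_zero_iff)
      then show ?thesis using 2 by (simp add: poly_prod poly_monom)
    qed (use assms in \<open>simp add: poly_prod poly_monom power_0_left\<close>)
  next
    have "degree (\<Prod>z\<in>?U. [:1, -z:]) \<le> (\<Sum>z\<in>?U. degree [:1, -z:])"
      using degree_prod_sum_le[OF fin, of "\<lambda>z. [:1, -z:]"] by (simp add: o_def)
    also have "\<dots> \<le> (\<Sum>z\<in>?U. 1)"
      by (rule sum_mono) auto
    finally have "degree (\<Prod>z\<in>?U. [:1, -z:]) \<le> n"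
      using cU by simp
    then show "degree (\<Prod>z\<in>?U. [:1, -z:]) < card (insert 0 ?U)"
      using fin cU \<open>0 \<notin> ?U\<close> by simp
  next
    have "degree (1 - monom 1 n :: complex poly) \<le> n"
      by (rule degree_diff_le) (auto simp: degree_monom_le)
    then show "degree (1 - monom 1 n :: complex poly) < card (insert 0 ?U)"
      using fin cU \<open>0 \<notin> ?U\<close> by simp
  qed
qed

text \<open>The coefficient of \<open>X ^ n\<close> in \<open>(1 - X) / (1 - X ^ p)\<close> for
  \<open>p > 1\<close>. The ring is left open because the values are compared in the complex numbers
  and in the reals.\<close>

definition unit_term :: "nat \<Rightarrow> nat \<Rightarrow> 'c::comm_ring_1" where
  "unit_term p n = (if n mod p = 0 then 1 else if n mod p = 1 then -1 else 0)"

context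
  fixes \<psi> :: "'a::{field,finite} \<Rightarrow> complex"
  assumes p: "prime (CARD('a))"
    and \<psi>_add: "\<And>x y. \<psi> (x + y) = \<psi> x * \<psi> y"
    and \<psi>_bij: "bij_betw \<psi> UNIV {z. z ^ CARD('a) = 1}"
begin

lemma \<psi>_0: "\<psi> 0 = 1"
proof -
  have "\<psi> 0 \<noteq> 0"
  proof
    assume "\<psi> 0 = 0"
    moreover have "\<psi> 0 \<in> {z. z ^ CARD('a) = 1}"
      using bij_betw_apply[OF \<psi>_bij] by blast
    ultimately show False by (simp add: power_0_left)
  qed
  then show ?thesis using \<psi>_add[of 0 0] by simp
qed

lemma \<psi>_sum_mset: "\<psi> (\<Sum>i\<in>#N. w i) = (\<Prod>i\<in>#N. \<psi> (w i))"
  by (induction N) (simp_all add: \<psi>_0 \<psi>_add)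

text \<open>For \<open>x \<noteq> 0\<close> the products \<open>j * x\<close> run through the field,
  so the sum is that of all \<open>p\<close>-th roots of unity.\<close>

lemma character_orthogonality:
  "(\<Sum>j\<in>UNIV. \<psi> (j * x)) = (if x = 0 then of_nat CARD('a) else 0)"
proof (cases "x = 0")
  case False
  have "(\<Sum>j\<in>UNIV. \<psi> (j * x)) = (\<Sum>j\<in>UNIV. \<psi> j)"
    by (rule sum.reindex_bij_witness[of _ "\<lambda>j. j / x" "\<lambda>j. j * x"]) (use False in auto)
  also have "\<dots> = \<Sum>{z. z ^ CARD('a) = 1}"
    using sum.reindex_bij_betw[OF \<psi>_bij, of "\<lambda>z. z"] by simp
  also have "\<dots> = 0"
    using sum_roots_unity[of "CARD('a)"] prime_gt_1_nat[OF p] by simp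
  finally show ?thesis using False by simp
qed (simp add: \<psi>_0)

text \<open>The generating function of these sums is \<open>(1 - X) / (1 - X\<^sup>p)\<close>.\<close>

lemma hsum_character:
  assumes "c \<noteq> 0"
  shows "hsum n (- {0}) (\<lambda>x. \<psi> (c * x)) = unit_term (CARD('a)) n"
proof -
  let ?p = "CARD('a)" and ?h = "\<lambda>n. hsum n (- {0}) (\<lambda>x. \<psi> (c * x))"
  have p2: "?p > 1" using prime_gt_1_nat[OF p] .
  \<comment> \<open>Taken over the whole field, the product does not depend on \<open>c\<close>,
    since multiplication by \<open>c\<close> is a permutation.\<close>
  have "(\<Prod>x\<in>UNIV. 1 - fps_const (\<psi> (c * x)) * fps_X) = (\<Prod>x\<in>UNIV. 1 - fps_const (\<psi> x) * fps_X)"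
    by (rule prod.reindex_bij_witness[of _ "\<lambda>j. j / c" "\<lambda>j. c * j"]) (use assms in auto)
  also have "\<dots> = (\<Prod>z\<in>{z. z ^ ?p = 1}. 1 - fps_const z * fps_X)"
    using prod.reindex_bij_betw[OF \<psi>_bij, of "\<lambda>z. 1 - fps_const z * fps_X"] by simp
  also have "\<dots> = (\<Prod>z\<in>{z. z ^ ?p = 1}. fps_of_poly [:1, -z:])"
    by (rule prod.cong) (simp_all add: fps_of_poly_pCons flip: fps_const_neg)
  also have "\<dots> = fps_of_poly (1 - monom 1 ?p)"
    using prod_roots_unity[of ?p] p2 by (simp add: fps_of_poly_prod[symmetric])
  also have "\<dots> = 1 - fps_X ^ ?p"
    by (simp add: fps_of_poly_diff fps_of_poly_monom')
  finally have prod: "(\<Prod>x\<in>UNIV. 1 - fps_const (\<psi> (c * x)) * fps_X) = 1 - fps_X ^ ?p" .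
  \<comment> \<open>The labels exclude 0, whose factor is \<open>1 - X\<close>; splitting it off
    produces the numerator.\<close>
  have "1 - fps_X ^ ?p = (1 - fps_X) * (\<Prod>x\<in>-{0}. 1 - fps_const (\<psi> (c * x)) * fps_X)"
    unfolding prod[symmetric]
    by (subst prod.remove[of UNIV 0]) (auto simp: \<psi>_0 Compl_eq_Diff_UNIV)
  then have "Abs_fps ?h * (1 - fps_X ^ ?p) = 1 - fps_X"
    using fps_hsum[of "-{0}" "\<lambda>x. \<psi> (c * x)"] by (simp add: mult.left_commute)
  then have coeffs: "fps_nth (Abs_fps ?h * (1 - fps_X ^ ?p)) n = fps_nth (1 - fps_X) n" for n
    by simp
  \<comment> \<open>Clearing the denominator gives a recurrence of step \<open>p\<close>; because
    \<open>p > 1\<close>, the start values are 1, -1, 0, ..., 0.\<close>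
  have rec: "?h n - (if n < ?p then 0 else ?h (n - ?p)) =
      (if n = 0 then 1 else if n = 1 then -1 else 0)" for n
    using coeffs[of n]
    by (simp add: right_diff_distrib fps_X_power_mult_right_nth fps_X_nth split: if_splits)
  show ?thesis
  proof (induction n rule: less_induct)
    case (less n)
    show ?case
    proof (cases "n < ?p")
      case True
      then show ?thesis using rec[of n] by (auto simp: unit_term_def split: if_splits)
    next
      case False
      then have "?h (n - ?p) = unit_term ?p (n - ?p)"
        using p2 by (intro less) auto
      then show ?thesis
        using rec[of n] False p2 by (auto simp: unit_term_def le_mod_geq)
    qed
  qed
qed

end

lemma hsum_const_1: "finite A \<Longrightarrow> hsum n A (\<lambda>_. 1) = of_nat ((card A + n - 1) choose n)"
  by (simp add: hsum_def card_multisets_of_size)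

section \<open>Families of multisets with a zero-sum condition\<close>

text \<open>A choice of one multiset of size \<open>s k\<close> over \<open>X k\<close> for every
  key \<open>k\<close>, merged into one multiset of tagged elements. In this form it is directly a
  multiset of orbit indices.\<close>

definition families :: "'k set \<Rightarrow> ('k \<Rightarrow> 'b set) \<Rightarrow> ('k \<Rightarrow> nat) \<Rightarrow> ('k \<times> 'b) multiset set" where
  "families K X s =
     {N. set_mset N \<subseteq> Sigma K X \<and> (\<forall>k\<in>K. size {#i \<in># N. fst i = k#} = s k)}"

text \<open>Filtering by a tag and then dropping the tag undoes the merging.\<close>

lemma bij_betw_families:
  assumes "finite K"
  shows "bij_betw (\<lambda>G. \<Sum>k\<in>K. image_mset (Pair k) (G k))
     (PiE K (\<lambda>k. multisets_of_size (X k) (s k))) (families K X s)" (is "bij_betw ?f ?A ?B")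
proof (rule bij_betw_byWitness[where f' = "\<lambda>N. \<lambda>k\<in>K. image_mset snd {#i \<in># N. fst i = k#}"])
  have filt: "{#i \<in># ?f G. fst i = k#} = image_mset (Pair k) (G k)" if "k \<in> K" for G k
  proof -
    have "{#i \<in># (\<Sum>k\<in>L. image_mset (Pair k) (G k)). fst i = k#} =
        (if k \<in> L then image_mset (Pair k) (G k) else {#})" if "finite L" for L
      using that
    proof (induction L rule: finite_induct)
      case (insert a L)
      have "{#i \<in># image_mset (Pair a) (G a). fst i = k#} = (if a = k then image_mset (Pair k) (G k) else {#})"
        by (auto simp: filter_mset_eq_conv)
      then show ?case using insert by auto
    qed simp
    then show ?thesis using assms that by simp
  qed
  show "\<forall>G\<in>?A. (\<lambda>k\<in>K. image_mset snd {#i \<in># ?f G. fst i = k#}) = G"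
  proof
    fix G assume G: "G \<in> ?A"
    show "(\<lambda>k\<in>K. image_mset snd {#i \<in># ?f G. fst i = k#}) = G"
    proof
      fix k
      show "(\<lambda>k\<in>K. image_mset snd {#i \<in># ?f G. fst i = k#}) k = G k"
      proof (cases "k \<in> K")
        case True
        then show ?thesis by (simp only: restrict_apply' filt) (simp add: multiset.map_comp o_def)
      next
        case False
        then show ?thesis using PiE_arb[OF G] by simp
      qed
    qed
  qed
  show "?f ` ?A \<subseteq> ?B"
  proof safe
    fix G assume G: "G \<in> ?A"
    have "set_mset (?f G) = (\<Union>k\<in>K. Pair k ` set_mset (G k))"
      using assms by (induction K rule: finite_induct) auto
    then show "?f G \<in> ?B"
      using G by (fastforce simp: families_def filt PiE_iff multisets_of_size_def)
  qed
  show "\<forall>N\<in>?B. ?f (\<lambda>k\<in>K. image_mset snd {#i \<in># N. fst i = k#}) = N"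
  proof
    fix N assume N: "N \<in> ?B"
    have "image_mset (Pair k) (image_mset snd {#i \<in># N. fst i = k#}) = {#i \<in># N. fst i = k#}" for k
    proof -
      have "image_mset (Pair k \<circ> snd) {#i \<in># N. fst i = k#} = image_mset id {#i \<in># N. fst i = k#}"
        by (rule image_mset_cong) auto
      then show ?thesis by (simp add: multiset.map_comp)
    qed
    then have "?f (\<lambda>k\<in>K. image_mset snd {#i \<in># N. fst i = k#}) = (\<Sum>k\<in>K. {#i \<in># N. fst i = k#})"
      by simp
    also have "\<dots> = {#i \<in># N. fst i \<in> K#}"
      using assms
    proof (induction K rule: finite_induct)
      case (insert a L)
      then have "{#i \<in># N. fst i \<in> insert a L#} = {#i \<in># N. fst i = a#} + {#i \<in># N. fst i \<in> L#}"
        by (auto simp: multiset_eq_iff)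
      then show ?case using insert by simp
    qed simp
    also have "\<dots> = N"
      using N by (auto simp: families_def filter_mset_eq_conv)
    finally show "?f (\<lambda>k\<in>K. image_mset snd {#i \<in># N. fst i = k#}) = N" .
  qed
  show "(\<lambda>N. \<lambda>k\<in>K. image_mset snd {#i \<in># N. fst i = k#}) ` ?B \<subseteq> ?A"
    by (fastforce simp: families_def multisets_of_size_def)
qed

lemma finite_families:
  assumes "finite K" "\<And>k. k \<in> K \<Longrightarrow> finite (X k)"
  shows "finite (families K X s)"
  using bij_betw_finite[OF bij_betw_families[OF assms(1)]] assms
  by (metis (no_types, lifting) finite_PiE finite_multisets_of_size)

text \<open>The product over a merged multiset splits by keys, and the distributive law turns the
  sum over all choices into a product of symmetric polynomials.\<close>

lemma sum_families:
  fixes g :: "'k \<times> 'b \<Rightarrow> 'c::comm_ring_1"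
  assumes "finite K" "\<And>k. k \<in> K \<Longrightarrow> finite (X k)"
  shows "(\<Sum>N\<in>families K X s. \<Prod>i\<in>#N. g i) = (\<Prod>k\<in>K. hsum (s k) (X k) (\<lambda>x. g (k, x)))"
proof -
  have "(\<Sum>N\<in>families K X s. \<Prod>i\<in>#N. g i) =
      (\<Sum>G\<in>PiE K (\<lambda>k. multisets_of_size (X k) (s k)).
        \<Prod>i\<in>#(\<Sum>k\<in>K. image_mset (Pair k) (G k)). g i)"
    by (rule sum.reindex_bij_betw[OF bij_betw_families[OF assms(1)], symmetric])
  also have "\<dots> = (\<Sum>G\<in>PiE K (\<lambda>k. multisets_of_size (X k) (s k)). \<Prod>k\<in>K. \<Prod>x\<in>#G k. g (k, x))"
  proof (rule sum.cong[OF refl])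
    fix G
    show "(\<Prod>i\<in>#(\<Sum>k\<in>K. image_mset (Pair k) (G k)). g i) = (\<Prod>k\<in>K. \<Prod>x\<in>#G k. g (k, x))"
      using assms(1) by (induction K rule: finite_induct) (simp_all add: multiset.map_comp o_def)
  qed
  also have "(\<Sum>G\<in>PiE K (\<lambda>k. multisets_of_size (X k) (s k)). \<Prod>k\<in>K. \<Prod>x\<in>#G k. g (k, x)) =
      (\<Prod>k\<in>K. hsum (s k) (X k) (\<lambda>x. g (k, x)))"
    unfolding hsum_def
    by (rule prod_sum_PiE[symmetric]) (use assms in auto)
  finally show ?thesis .
qed

text \<open>This is the shape in which the average over \<open>p\<close> characters arises: the
  trivial one contributes \<open>B_num\<close>, each of the other \<open>p - 1\<close> the product
  of unit terms. That product is 0 as soon as an entry is neither 0 nor 1 modulo \<open>p\<close>,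
  and the sign \<open>(-1) ^ t_num p Q\<close> otherwise.\<close>

lemma W_num_eq:
  "W_num p Q = (real (B_num p Q) + (real p - 1) * (\<Prod>\<mu>\<in>#Q. unit_term p \<mu>)) / real p"
  if "p > 1"
proof -
  have "(\<Prod>\<mu>\<in>#Q. unit_term p \<mu>) =
    (if \<exists>\<mu>\<in>#Q. \<mu> mod p \<noteq> 0 \<and> \<mu> mod p \<noteq> 1 then 0 else (-1 :: real) ^ t_num p Q)"
    by (induction Q) (auto simp: unit_term_def t_num_def)
  then show ?thesis
    using that by (simp add: W_num_def field_simps)
qed

text \<open>A zero entry contributes a factor 1 to both products. Orbits of lines that carry no
  vectors are keys of load 0, whereas expressions list only non-zero loads.\<close>

lemma W_num_add_zeros:
  assumes "p > 1"
  shows "W_num p (filter_mset (\<lambda>k. k \<noteq> 0) Q) = W_num p Q"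
proof -
  have "B_num p (filter_mset (\<lambda>k. k \<noteq> 0) Q) = B_num p Q"
    by (induction Q) (simp_all add: B_num_def)
  moreover have "(\<Prod>\<mu>\<in>#filter_mset (\<lambda>k. k \<noteq> 0) Q. unit_term p \<mu> :: real) = (\<Prod>\<mu>\<in>#Q. unit_term p \<mu>)"
    by (induction Q) (simp_all add: unit_term_def)
  ultimately show ?thesis using W_num_eq[OF assms] by simp
qed

text \<open>
  The keys in \<open>K\<^sub>1\<close> constrain the weighted sum; the remaining ones are free. Averaging over all
  additive characters, each of the \<open>p - 1\<close> non-trivial ones contributes the same product.
\<close>

lemma card_families_zero_sum:
  fixes c :: "'k \<Rightarrow> 'a::{field,finite}" and X :: "'k \<Rightarrow> 'a set"
  assumes p: "prime (CARD('a))" and "finite K" "K\<^sub>1 \<subseteq> K"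
    and X: "\<And>k. k \<in> K\<^sub>1 \<Longrightarrow> X k = - {0}"
    and c: "\<And>k. k \<in> K\<^sub>1 \<Longrightarrow> c k \<noteq> 0" "\<And>k. k \<in> K - K\<^sub>1 \<Longrightarrow> c k = 0"
  shows "real (card {N \<in> families K X s. (\<Sum>i\<in>#N. c (fst i) * snd i) = 0}) =
     (\<Prod>k\<in>K - K\<^sub>1. real ((card (X k) + s k - 1) choose s k)) *
     W_num (CARD('a)) (image_mset s (mset_set K\<^sub>1))"
proof -
  let ?p = "CARD('a)" and ?F = "families K X s" and ?w = "\<lambda>N. \<Sum>i\<in>#N. c (fst i) * snd i"
  obtain \<psi> :: "'a \<Rightarrow> complex" where add: "\<And>x y. \<psi> (x + y) = \<psi> x * \<psi> y"
      and bij: "bij_betw \<psi> UNIV {z. z ^ CARD('a) = 1}"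
    using additive_character_exists[OF p] by blast
  note ch = p add bij
  define b where "b = (\<Prod>k\<in>K - K\<^sub>1. real ((card (X k) + s k - 1) choose s k))"
  define d where "d = (\<Prod>k\<in>K\<^sub>1. real ((s k + ?p - 2) choose s k))"
  define e :: real where "e = (\<Prod>k\<in>K\<^sub>1. unit_term ?p (s k))"
  have p1: "?p > 1" using prime_gt_1_nat[OF p] .
  have fin: "finite ?F" by (rule finite_families) (use assms in auto)
  have split: "(\<Prod>k\<in>K. f k) = (\<Prod>k\<in>K - K\<^sub>1. f k) * (\<Prod>k\<in>K\<^sub>1. f k)" for f :: "'k \<Rightarrow> complex"
    using assms by (simp add: prod.subset_diff)
  \<comment> \<open>For \<open>j = 0\<close>, or a free key, all values of the character are 1 and
    multisets are merely counted. For \<open>j \<noteq> 0\<close> and a constrained key,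
    \<open>j * c k\<close> is non-zero and the unit term appears.\<close>
  have factors: "(\<Prod>k\<in>K. hsum (s k) (X k) (\<lambda>x. \<psi> (j * (c k * x)))) =
      of_real (b * (if j = 0 then d else e))" for j
  proof -
    have "hsum (s k) (X k) (\<lambda>x. \<psi> (j * (c k * x))) =
        of_real (if j = 0 then real ((s k + ?p - 2) choose s k) else unit_term ?p (s k))"
      if "k \<in> K\<^sub>1" for k
    proof (cases "j = 0")
      case True
      have "card (- {0::'a}) + s k - 1 = s k + ?p - 2"
        using p1 by (simp add: Compl_eq_Diff_UNIV card_Diff_subset)
      then show ?thesis
        using that True X by (simp add: \<psi>_0[OF ch] hsum_const_1)
    next
      case False
      then show ?thesis
        using that X c hsum_character[OF ch, of "j * c k" "s k"]
        by (simp add: mult.assoc unit_term_def)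
    qed
    moreover have "hsum (s k) (X k) (\<lambda>x. \<psi> (j * (c k * x))) =
        of_real (real ((card (X k) + s k - 1) choose s k))" if "k \<in> K - K\<^sub>1" for k
      using that c by (simp add: \<psi>_0[OF ch] hsum_const_1)
    ultimately show ?thesis
      by (simp add: split b_def d_def e_def)
  qed
  \<comment> \<open>By orthogonality, summing \<open>\<psi> (j * w)\<close> over \<open>j\<close>
    gives \<open>p\<close> times the indicator of \<open>w = 0\<close>.\<close>
  have "of_nat ?p * of_nat (card {N \<in> ?F. ?w N = 0}) = (\<Sum>N\<in>?F. if ?w N = 0 then of_nat ?p else 0 :: complex)"
    using fin by (simp add: sum.If_cases Int_def)
  also have "\<dots> = (\<Sum>N\<in>?F. \<Sum>j\<in>UNIV. \<psi> (j * ?w N))"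
    by (simp add: character_orthogonality[OF ch])
  also have "\<dots> = (\<Sum>j\<in>UNIV. \<Sum>N\<in>?F. \<Prod>i\<in>#N. \<psi> (j * (c (fst i) * snd i)))"
    by (subst sum.swap) (simp add: \<psi>_sum_mset[OF ch] sum_mset_distrib_left)
  also have "\<dots> = (\<Sum>j\<in>UNIV. \<Prod>k\<in>K. hsum (s k) (X k) (\<lambda>x. \<psi> (j * (c k * x))))"
    by (rule sum.cong[OF refl], subst sum_families) (use assms in auto)
  also have "\<dots> = (\<Sum>j\<in>UNIV. of_real (b * (if j = (0::'a) then d else e)))"
    by (simp only: factors)
  also have "\<dots> = of_real (b * (d + (real ?p - 1) * e))"
  proof -
    have "(\<Sum>j\<in>UNIV. if j = (0::'a) then d else e) = d + (\<Sum>j\<in>UNIV - {0::'a}. e)"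
      by (subst sum.remove[of UNIV 0]) auto
    also have "\<dots> = d + (real ?p - 1) * e"
      using p1 by (simp add: card_Diff_subset of_nat_diff)
    finally have "(\<Sum>j\<in>UNIV. b * (if j = (0::'a) then d else e)) = b * (d + (real ?p - 1) * e)"
      by (simp add: sum_distrib_left[symmetric])
    then show ?thesis by (metis of_real_sum)
  qed
  finally have "complex_of_real (real ?p * real (card {N \<in> ?F. ?w N = 0})) =
      of_real (b * (d + (real ?p - 1) * e))" by simp
  then have "real ?p * real (card {N \<in> ?F. ?w N = 0}) = b * (d + (real ?p - 1) * e)"
    using of_real_eq_iff by blast
  moreover have "W_num ?p (image_mset s (mset_set K\<^sub>1)) = (d + (real ?p - 1) * e) / real ?p"
  proof -
    have "real (\<Prod>k\<in>#Q. f k) = (\<Prod>k\<in>#Q. real (f k))" for Q and f :: "'k \<Rightarrow> nat"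
      by (induction Q) simp_all
    then show ?thesis
      by (simp add: W_num_eq[OF p1] d_def e_def B_num_def prod_unfold_prod_mset multiset.map_comp o_def)
  qed
  ultimately have "real ?p * real (card {N \<in> ?F. ?w N = 0}) =
      real ?p * (b * W_num ?p (image_mset s (mset_set K\<^sub>1)))"
    using p1 by simp
  then show ?thesis
    using p1 by (simp add: b_def)
qed

section \<open>Distributing prescribed loads over a finite set\<close>

lemma card_functions_with_image_mset:
  fixes A :: "'b multiset"
  assumes "finite R"
  shows "card {s \<in> R \<rightarrow>\<^sub>E UNIV. image_mset s (mset_set R) = A} * (\<Prod>x\<in>set_mset A. fact (count A x)) =
     (if size A = card R then fact (size A) else 0)"
proof -
  obtain xs where xs: "set xs = R" "distinct xs"
    using finite_distinct_list[OF assms] by blast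
  have mset_R: "mset_set R = mset xs"
    using xs by (metis mset_set_set)
  have inj: "inj_on (\<lambda>s. map s xs) (R \<rightarrow>\<^sub>E UNIV)"
    unfolding xs(1)[symmetric] by (force simp: inj_on_def intro: PiE_ext)
  \<comment> \<open>Along a fixed enumeration of \<open>R\<close>, such functions are the
    arrangements of \<open>A\<close> as a list.\<close>
  have "(\<lambda>s. map s xs) ` {s \<in> R \<rightarrow>\<^sub>E (UNIV :: 'b set). image_mset s (mset_set R) = A} =
      (if size A = card R then permutations_of_multiset A else {})" (is "_ ` ?S = ?P")
  proof (intro equalityI subsetI)
    fix ys assume "ys \<in> (\<lambda>s. map s xs) ` ?S"
    then obtain s where "ys = map s xs" "image_mset s (mset xs) = A"
      by (auto simp: mset_R)
    moreover from this have "size A = card R"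
      using xs distinct_card by force
    ultimately show "ys \<in> ?P"
      by (auto simp: permutations_of_multiset_def)
  next
    fix ys assume "ys \<in> ?P"
    then have ys: "mset ys = A" and len: "length ys = length xs"
      using distinct_card[OF xs(2)] xs(1)
      by (auto simp: permutations_of_multiset_def split: if_splits)
    define s where "s = (\<lambda>x\<in>R. the (map_of (zip xs ys) x))"
    have "map s xs = ys"
    proof (rule nth_equalityI)
      fix i assume "i < length (map s xs)"
      then show "map s xs ! i = ys ! i"
        using xs len by (auto simp: s_def map_of_zip_nth)
    qed (simp add: len)
    moreover from this have "image_mset s (mset_set R) = A"
      using ys by (simp add: mset_R flip: mset_map)
    moreover have "s \<in> R \<rightarrow>\<^sub>E UNIV" by (simp add: s_def)
    ultimately show "ys \<in> (\<lambda>s. map s xs) ` ?S" by blast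
  qed
  then have "card ?S = card ?P"
    using card_image[OF inj_on_subset[OF inj, of ?S]] by auto
  moreover have "card (permutations_of_multiset A) * (\<Prod>x\<in>set_mset A. fact (count A x)) = fact (size A)"
    using card_permutations_of_multiset[of A] by simp
  ultimately show ?thesis by auto
qed

text \<open>The remaining points of \<open>R\<close> carry the value 0, so \<open>B\<close> is
  padded by \<open>card R - size B\<close> zeros. The permutations of these zeros give the first
  factorial in the denominator.\<close>

lemma card_functions_with_nonzero_image_mset:
  fixes B :: "nat multiset"
  assumes "finite R" "0 \<notin># B" "size B \<le> card R"
  shows "real (card {s \<in> R \<rightarrow>\<^sub>E UNIV. filter_mset (\<lambda>k. k \<noteq> 0) (image_mset s (mset_set R)) = B}) =
     fact (card R) / (fact (card R - size B) * (\<Prod>q\<in>set_mset B. fact (count B q)))"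
proof -
  define r where "r = card R - size B"
  define A where "A = B + replicate_mset r (0::nat)"
  have eq: "filter_mset (\<lambda>k. k \<noteq> 0) M = B \<longleftrightarrow> M = A" if "size M = card R" for M
  proof
    assume *: "filter_mset (\<lambda>k. k \<noteq> 0) M = B"
    have "M = filter_mset (\<lambda>k. k \<noteq> 0) M + filter_mset (\<lambda>k. \<not> k \<noteq> 0) M"
      by (rule multiset_partition)
    moreover have "filter_mset (\<lambda>k. \<not> k \<noteq> 0) M = replicate_mset (count M 0) 0"
      by (simp add: filter_eq_replicate_mset)
    ultimately have M: "M = B + replicate_mset (count M 0) 0"
      using * by metis
    then have "size M = size B + count M 0" by (metis size_replicate_mset size_union)
    then show "M = A" using M that by (simp add: A_def r_def)
  next
    assume "M = A"
    then show "filter_mset (\<lambda>k. k \<noteq> 0) M = B"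
      using assms(2) by (simp add: A_def multiset_eq_iff not_in_iff)
  qed
  have set_eq: "{s \<in> R \<rightarrow>\<^sub>E UNIV. filter_mset (\<lambda>k. k \<noteq> 0) (image_mset s (mset_set R)) = B} =
      {s \<in> R \<rightarrow>\<^sub>E UNIV. image_mset s (mset_set R) = A}" (is "?S = _")
    using eq by auto
  have sizeA: "size A = card R"
    using assms by (simp add: A_def r_def)
  have "(\<Prod>x\<in>set_mset A. fact (count A x)) = (\<Prod>x\<in>insert 0 (set_mset B). fact (count A x) :: nat)"
    by (rule prod.mono_neutral_left) (auto simp: A_def not_in_iff split: if_splits)
  also have "\<dots> = fact r * (\<Prod>x\<in>set_mset B. fact (count A x))"
    using assms by (simp add: A_def not_in_iff)
  also have "(\<Prod>x\<in>set_mset B. fact (count A x)) = (\<Prod>x\<in>set_mset B. fact (count B x) :: nat)"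
    using assms by (intro prod.cong) (auto simp: A_def)
  finally have "card ?S * (fact r * (\<Prod>x\<in>set_mset B. fact (count B x))) = fact (card R)"
    using card_functions_with_image_mset[OF assms(1), of A] sizeA by (simp only: set_eq if_True simp_thms)
  then have "real (card ?S) * (fact r * (\<Prod>x\<in>set_mset B. fact (count B x))) = fact (card R)"
    by (metis (mono_tags, lifting) of_nat_fact of_nat_mult of_nat_prod prod.cong)
  moreover have "fact r * (\<Prod>x\<in>set_mset B. fact (count B x)) \<noteq> (0::real)"
    by (simp add: fact_nonzero)
  ultimately show ?thesis
    unfolding r_def by (simp add: field_simps)
qed

section \<open>Multisets fixed by a permutation\<close>

definition tiled :: "('i \<Rightarrow> 'v set) \<Rightarrow> 'i multiset \<Rightarrow> 'v multiset" where
  "tiled Orb N = (\<Sum>i\<in>#N. mset_set (Orb i))"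

lemma tiled_simps [simp]:
  "tiled Orb {#} = {#}" "tiled Orb (add_mset i N) = mset_set (Orb i) + tiled Orb N"
  by (simp_all add: tiled_def)

lemma size_filter_tiled:
  "\<forall>i\<in>#N. finite (Orb i) \<Longrightarrow>
    size (filter_mset P (tiled Orb N)) = (\<Sum>i\<in>#N. card {v \<in> Orb i. P v})"
  by (induction N) simp_all

lemma sum_mset_tiled: "sum_mset (tiled Orb N) = (\<Sum>i\<in>#N. \<Sum>(Orb i))"
  by (induction N) (simp_all add: sum_unfold_sum_mset)

lemma set_mset_tiled: "\<forall>i\<in>#N. finite (Orb i) \<Longrightarrow> set_mset (tiled Orb N) = (\<Union>i\<in>set_mset N. Orb i)"
  by (induction N) simp_all

lemma count_tiled:
  assumes "set_mset N \<subseteq> I" "i \<in> I" "v \<in> Orb i" "\<And>i. i \<in> I \<Longrightarrow> finite (Orb i)"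
    "disjoint_family_on Orb I"
  shows "count (tiled Orb N) v = count N i"
  using assms(1)
proof (induction N)
  case (add j N)
  have "v \<in> Orb j \<longleftrightarrow> j = i"
    using add.prems assms(2,3,5) by (fastforce simp: disjoint_family_on_def)
  then show ?case
    using add assms by (auto simp: count_mset_set')
qed simp

lemma image_mset_bij_fixed_iff:
  assumes "bij g"
  shows "image_mset g M = M \<longleftrightarrow> (\<forall>v. count M (g v) = count M v)"
proof -
  have inj: "inj g" and surj: "surj g" using assms by (auto simp: bij_def)
  have eq: "count (image_mset g M) (g v) = count M v" for v
    using inj by (induction M) (auto simp: inj_eq)
  show ?thesis
  proof
    assume "image_mset g M = M"
    then show "\<forall>v. count M (g v) = count M v" using eq by metis
  next
    assume *: "\<forall>v. count M (g v) = count M v"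
    show "image_mset g M = M"
    proof (rule multiset_eqI)
      fix w
      obtain v where "w = g v" using surj by blast
      then show "count (image_mset g M) w = count M w" using eq * by simp
    qed
  qed
qed

text \<open>Invariance makes multiplicities constant along each orbit, and this common multiplicity
  is the number of times the orbit is used. The condition \<open>inv\<close> says that the
  complement of the union is mapped into itself, so multiplicity 0 there is compatible with
  invariance.\<close>

lemma bij_betw_tiled:
  fixes g :: "'v \<Rightarrow> 'v"
  assumes "bij g" "finite I"
    and fin: "\<And>i. i \<in> I \<Longrightarrow> finite (Orb i)" and disj: "disjoint_family_on Orb I"
    and orb: "\<And>i. i \<in> I \<Longrightarrow> \<exists>b. Orb i = range (\<lambda>k. (g ^^ k) b)"
    and inv: "\<And>v. g v \<in> (\<Union>i\<in>I. Orb i) \<Longrightarrow> v \<in> (\<Union>i\<in>I. Orb i)"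
  shows "bij_betw (tiled Orb) {N. set_mset N \<subseteq> I}
     {M. set_mset M \<subseteq> (\<Union>i\<in>I. Orb i) \<and> image_mset g M = M}" (is "bij_betw _ ?A ?B")
proof (rule bij_betw_imageI)
  have ne: "\<exists>v. v \<in> Orb i" if "i \<in> I" for i
    using orb[OF that] by blast
  have ct: "count (tiled Orb N) v = count N i" if "N \<in> ?A" "i \<in> I" "v \<in> Orb i" for N i v
    using count_tiled[of N I i v Orb] that fin disj by auto
  show "inj_on (tiled Orb) ?A"
  proof (rule inj_onI, rule multiset_eqI)
    fix N N' i
    assume N: "N \<in> ?A" "N' \<in> ?A" "tiled Orb N = tiled Orb N'"
    show "count N i = count N' i"
    proof (cases "i \<in> I")
      case True
      then show ?thesis using ct N ne by metis
    next
      case False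
      then have "i \<notin># N" "i \<notin># N'" using N by auto
      then show ?thesis by (simp add: not_in_iff)
    qed
  qed
  have step: "g v \<in> Orb i" if i: "i \<in> I" and v: "v \<in> Orb i" for i v
  proof -
    obtain b k where "Orb i = range (\<lambda>k. (g ^^ k) b)" "v = (g ^^ k) b"
      using orb[OF i] v by auto
    then show ?thesis by (auto intro!: range_eqI[of _ _ "Suc k"])
  qed
  show "tiled Orb ` ?A = ?B"
  proof (intro equalityI subsetI)
    fix M assume "M \<in> tiled Orb ` ?A"
    then obtain N where N: "N \<in> ?A" and M: "M = tiled Orb N" by blast
    have sub: "set_mset M \<subseteq> (\<Union>i\<in>I. Orb i)"
      using N fin set_mset_tiled[of N Orb] M by blast
    have "count M (g v) = count M v" for v
    proof (cases "v \<in> (\<Union>i\<in>I. Orb i)")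
      case True
      then show ?thesis using step ct[OF N] M by auto
    next
      case False
      then show ?thesis using inv sub by (metis not_in_iff subsetD)
    qed
    then show "M \<in> ?B"
      using sub image_mset_bij_fixed_iff[OF assms(1)] by blast
  next
    fix M assume M: "M \<in> ?B"
    then have inv_count: "count M (g v) = count M v" for v
      using image_mset_bij_fixed_iff[OF assms(1)] by blast
    have pow_count: "count M ((g ^^ k) b) = count M b" for k b
      by (induction k) (simp_all add: inv_count)
    define c where "c i = count M (SOME v. v \<in> Orb i)" for i
    have c: "count M v = c i" if i: "i \<in> I" and v: "v \<in> Orb i" for i v
    proof -
      have "(SOME v. v \<in> Orb i) \<in> Orb i" using v by (rule someI)
      then show ?thesis using orb[OF i] v pow_count unfolding c_def by fastforce
    qed
    define N where "N = (\<Sum>i\<in>I. replicate_mset (c i) i)"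
    have count_N: "count N i = (if i \<in> I then c i else 0)" for i
      using assms(2) by (simp add: N_def count_sum)
    have N: "N \<in> ?A"
      using count_N by (metis (mono_tags) mem_Collect_eq not_in_iff subsetI)
    have "tiled Orb N = M"
    proof (rule multiset_eqI)
      fix v
      show "count (tiled Orb N) v = count M v"
      proof (cases "v \<in> (\<Union>i\<in>I. Orb i)")
        case True
        then show ?thesis using ct[OF N] c count_N by auto
      next
        case False
        then have "v \<notin># M" "v \<notin># tiled Orb N"
          using M N fin set_mset_tiled[of N Orb] by blast+
        then show ?thesis by (simp add: not_in_iff)
      qed
    qed
    then show "M \<in> tiled Orb ` ?A" using N by blast
  qed
qed

section \<open>Lines and partition types in coordinates\<close>

locale frame =
  fixes v\<^sub>1 v\<^sub>2 :: "'a::{field,finite}^2"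
  assumes indep: "a *s v\<^sub>1 + b *s v\<^sub>2 = 0 \<Longrightarrow> a = 0 \<and> b = 0"
begin

definition pt :: "'a \<Rightarrow> 'a \<Rightarrow> 'a^2" where
  "pt a b = a *s v\<^sub>1 + b *s v\<^sub>2"

lemma pt_add: "pt a b + pt c d = pt (a + c) (b + d)"
  by (simp add: pt_def vec.scale_left_distrib)

lemma pt_scale: "c *s pt a b = pt (c * a) (c * b)"
  by (simp add: pt_def vec.scale_right_distrib vec.scale_scale)

lemma pt_0 [simp]: "pt 0 0 = 0"
  by (simp add: pt_def)

lemma pt_eq_iff [simp]: "pt a b = pt c d \<longleftrightarrow> a = c \<and> b = d"
proof
  assume "pt a b = pt c d"
  then have "(a - c) *s v\<^sub>1 + (b - d) *s v\<^sub>2 = 0"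
    by (simp add: pt_def vec.scale_left_diff_distrib algebra_simps)
  from indep[OF this] show "a = c \<and> b = d" by simp
qed simp

lemma pt_eq_0_iff [simp]: "pt a b = 0 \<longleftrightarrow> a = 0 \<and> b = 0"
  using pt_eq_iff[of a b 0 0] by simp

lemma sum_pt: "(\<Sum>x\<in>A. pt (f x) (g x)) = pt (sum f A) (sum g A)"
  by (induction A rule: infinite_finite_induct) (simp_all add: pt_add)

lemma sum_mset_pt: "(\<Sum>x\<in>#N. pt (f x) (g x)) = pt (\<Sum>x\<in>#N. f x) (\<Sum>x\<in>#N. g x)"
  by (induction N) (simp_all add: pt_add)

text \<open>Independence makes the coordinate map injective, and both sides have the same finite
  cardinality.\<close>

lemma pt_exhaust: obtains a b where "v = pt a b"
proof -
  have "inj (\<lambda>(a, b). pt a b)" by (auto simp: inj_def)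
  then have "card (range (\<lambda>(a, b). pt a b)) = CARD('a \<times> 'a)"
    by (rule card_image)
  also have "\<dots> = CARD('a^2)"
    by (simp add: power2_eq_square)
  finally have "range (\<lambda>(a, b). pt a b) = UNIV"
    by (intro card_subset_eq) auto
  then have "v \<in> range (\<lambda>(a, b). pt a b)" by blast
  then show ?thesis using that by auto
qed

text \<open>Lines are indexed by their slope, which is \<open>None\<close> for the second axis.\<close>

definition line :: "'a option \<Rightarrow> ('a^2) set" where
  "line k = (case k of None \<Rightarrow> range (pt 0) | Some t \<Rightarrow> range (\<lambda>a. pt a (a * t)))"

lemma pt_in_line [simp]:
  "pt a b \<in> line None \<longleftrightarrow> a = 0"
  "pt a b \<in> line (Some t) \<longleftrightarrow> b = a * t"
  by (auto simp: line_def)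

lemma zero_in_line [simp]: "0 \<in> line k"
  by (cases k) (simp_all flip: pt_0)

lemma subspace_line: "vec.subspace (line k)"
proof (rule vec.subspaceI)
  show "u + v \<in> line k" if "u \<in> line k" "v \<in> line k" for u v
    using that
    by (cases k; cases u rule: pt_exhaust; cases v rule: pt_exhaust)
      (auto simp: pt_add algebra_simps)
  show "c *s u \<in> line k" if "u \<in> line k" for c u
    using that by (cases k; cases u rule: pt_exhaust) (auto simp: pt_scale)
qed simp

lemma line_neq_UNIV: "line k \<noteq> UNIV"
proof (cases k)
  case None
  then have "pt 1 0 \<notin> line k" by simp
  then show ?thesis by blast
next
  case (Some t)
  then have "pt 0 1 \<notin> line k" by simp
  then show ?thesis by blast
qed

text \<open>The slope of \<open>pt a b\<close> is \<open>None\<close> for \<open>a = 0\<close> and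
  \<open>Some (b / a)\<close> otherwise.\<close>

lemma unique_line: "v \<noteq> 0 \<Longrightarrow> \<exists>!k. v \<in> line k"
proof (cases v rule: pt_exhaust)
  case (1 a b)
  assume "v \<noteq> 0"
  show ?thesis
  proof (cases "a = 0")
    case True
    have "k = None" if "v \<in> line k" for k
      using that 1 True \<open>v \<noteq> 0\<close> by (cases k) auto
    then show ?thesis using 1 True by (intro ex1I[of _ None]) auto
  next
    case False
    have "k = Some (b / a)" if "v \<in> line k" for k
      using that 1 False by (cases k) auto
    then show ?thesis using 1 False by (intro ex1I[of _ "Some (b / a)"]) auto
  qed
qed

lemma nonzero_in_line: obtains v where "v \<in> line k" "v \<noteq> 0"
proof (cases k)
  case None
  then show ?thesis using that[of "pt 0 1"] by simp
next
  case (Some t)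
  then show ?thesis using that[of "pt 1 t"] by simp
qed

lemma inj_line: "inj line"
proof (rule injI)
  fix k k' assume eq: "line k = line k'"
  obtain v where "v \<in> line k" "v \<noteq> 0" by (rule nonzero_in_line)
  then show "k = k'" using eq unique_line[of v] by auto
qed

lemma dim_UNIV_2: "vec.dim (UNIV :: ('a^2) set) = 2"
  by (simp add: vec_dim_card card_cart_basis)

lemma line_eq_span:
  assumes "v \<in> line k" "v \<noteq> 0"
  shows "line k = vec.span {v}"
proof
  show "vec.span {v} \<subseteq> line k"
    using assms(1) subspace_line by (simp add: vec.span_minimal)
  obtain a b where v: "v = pt a b" by (rule pt_exhaust)
  show "line k \<subseteq> vec.span {v}"
  proof
    fix u assume u: "u \<in> line k"
    obtain c d where cd: "u = pt c d" by (rule pt_exhaust)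
    have "\<exists>r. u = r *s v"
    proof (cases k)
      case None
      then have "u = (d / b) *s v" using u v cd assms by (auto simp: pt_scale)
      then show ?thesis ..
    next
      case (Some t)
      then have "u = (c / a) *s v" using u v cd assms by (auto simp: pt_scale)
      then show ?thesis ..
    qed
    then show "u \<in> vec.span {v}" by (auto simp: vec.span_singleton)
  qed
qed

lemma lines_eq: "lines = range line"
proof (intro equalityI subsetI)
  fix L :: "('a^2) set" assume "L \<in> lines"
  then have L: "vec.subspace L" "vec.dim L = 1" by (auto simp: lines_def)
  obtain B where B: "B \<subseteq> L" "vec.independent B" "L \<subseteq> vec.span B" "card B = vec.dim L"
    using vec.basis_exists by blast
  then obtain v where v: "B = {v}" using L by (auto simp: card_1_singleton_iff)
  then have "v \<noteq> 0" using B by (auto simp: vec.dependent_zero)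
  moreover have "L = vec.span {v}"
    using B v L vec.span_minimal by blast
  ultimately show "L \<in> range line" using unique_line[of v] line_eq_span by blast
next
  fix L assume "L \<in> range line"
  then obtain k where k: "L = line k" by blast
  obtain v where "v \<in> line k" "v \<noteq> 0" by (rule nonzero_in_line)
  then have "vec.dim (line k) = 1"
    using line_eq_span[of v k] vec.dim_eq_card_independent[of "{v}"]
    by (simp add: vec.dim_span)
  then show "L \<in> lines" using k subspace_line by (simp add: lines_def)
qed

text \<open>A set of non-zero vectors that fits into no line contains a vector \<open>v\<close> and
  another one off the line through \<open>v\<close>; two independent vectors span the plane.\<close>

lemma span_eq_UNIV_iff:
  assumes "0 \<notin> S"
  shows "vec.span S = UNIV \<longleftrightarrow> \<not> (\<exists>k. S \<subseteq> line k)"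
proof
  assume span: "vec.span S = UNIV"
  show "\<not> (\<exists>k. S \<subseteq> line k)"
  proof
    assume "\<exists>k. S \<subseteq> line k"
    then obtain k where "S \<subseteq> line k" ..
    then have "vec.span S \<subseteq> line k" using subspace_line by (rule vec.span_minimal)
    then show False using span line_neq_UNIV[of k] by auto
  qed
next
  assume *: "\<not> (\<exists>k. S \<subseteq> line k)"
  then obtain v where v: "v \<in> S" by blast
  then have v0: "v \<noteq> 0" using assms by auto
  then obtain k where k: "v \<in> line k" using unique_line by blast
  obtain u where u: "u \<in> S" "u \<notin> line k" using * by blast
  then have "u \<notin> vec.span {v}" using line_eq_span[OF k v0] by simp
  then have ind: "vec.independent {u, v}" and ne: "u \<noteq> v"
    using v0 vec.span_base by (auto simp: vec.independent_insert)
  have "vec.dim (UNIV :: ('a^2) set) \<le> card {u, v}"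
    using ne dim_UNIV_2 by simp
  then have "UNIV \<subseteq> vec.span {u, v}"
    by (intro vec.card_ge_dim_independent[OF _ ind]) auto
  moreover have "vec.span {u, v} \<subseteq> vec.span S"
    using u v by (intro vec.span_mono) auto
  ultimately show "vec.span S = UNIV" by blast
qed

abbreviation on_line :: "('a^2) multiset \<Rightarrow> 'a option \<Rightarrow> nat" where
  "on_line M k \<equiv> size {#v \<in># M. v \<in> line k#}"

lemma partition_type_eq:
  "partition_type M = filter_mset (\<lambda>k. k \<noteq> 0) (image_mset (on_line M) (mset_set UNIV))"
  for M :: "('a^2) multiset"
proof -
  have "mset_set lines = image_mset line (mset_set UNIV)"
    by (simp add: lines_eq image_mset_mset_set inj_line)
  then show ?thesis by (simp add: partition_type_def multiset.map_comp o_def)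
qed

lemma sum_mset_partition_type:
  fixes M :: "('a^2) multiset"
  assumes "0 \<notin># M"
  shows "sum_mset (partition_type M) = size M"
proof -
  have "sum_mset (partition_type M) = (\<Sum>k\<in>UNIV. on_line M k)"
  proof -
    have "sum_mset (filter_mset (\<lambda>k. k \<noteq> 0) A) = sum_mset A" for A :: "nat multiset"
      by (induction A) auto
    then show ?thesis by (simp add: partition_type_eq sum_unfold_sum_mset)
  qed
  also have "\<dots> = size M"
    using assms
  proof (induction M)
    case (add v M)
    then obtain k where k: "\<And>k'. v \<in> line k' \<longleftrightarrow> k' = k"
      using unique_line[of v] by auto
    have "(\<Sum>k\<in>UNIV. on_line (add_mset v M) k) = (\<Sum>k'\<in>UNIV. (if k' = k then 1 else 0) + on_line M k')"
      by (rule sum.cong) (auto simp: k)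
    then show ?case using add by (simp add: sum.distrib)
  qed simp
  finally show ?thesis .
qed

lemma size_partition_type:
  "size (partition_type M) = card {k. \<exists>v\<in>#M. v \<in> line k}"
  for M :: "('a^2) multiset"
proof -
  have "size (partition_type M) = size (filter_mset (\<lambda>k. on_line M k \<noteq> 0) (mset_set UNIV))"
    by (simp only: partition_type_eq filter_mset_image_mset size_image_mset)
  also have "(\<lambda>k. on_line M k \<noteq> 0) = (\<lambda>k. \<exists>v\<in>#M. v \<in> line k)"
    unfolding size_eq_0_iff_empty filter_mset_eq_mempty_iff by blast
  finally show ?thesis by simp
qed

text \<open>Only the sum is not visible in the partition type: the size is the sum of the parts, and
  spanning means that at least two lines are met. Hence for a given type the vanishing of the sum is
  all that has to be counted.\<close>

lemma zero_sum_multiset_iff: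
  fixes M :: "('a^2) multiset"
  assumes "0 \<notin># M"
  shows "zero_sum_multiset M \<longleftrightarrow>
    sum_mset M = 0 \<and> sum_mset (partition_type M) \<ge> 3 \<and> size (partition_type M) \<ge> 2"
proof -
  let ?K = "{k. \<exists>v\<in>#M. v \<in> line k}"
  have "(\<exists>k. set_mset M \<subseteq> line k) \<longleftrightarrow> card ?K \<le> 1"
  proof
    assume "\<exists>k. set_mset M \<subseteq> line k"
    then obtain k where k: "set_mset M \<subseteq> line k" by blast
    have "?K \<subseteq> {k}"
    proof
      fix k' assume "k' \<in> ?K"
      then obtain v where v: "v \<in># M" "v \<in> line k'" by blast
      then have "v \<noteq> 0" using assms by auto
      then show "k' \<in> {k}" using unique_line[of v] v k by auto
    qed
    then show "card ?K \<le> 1"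
      using card_mono[of "{k}" ?K] by simp
  next
    assume "card ?K \<le> 1"
    then consider "?K = {}" | k where "?K = {k}"
      by (metis (no_types, lifting) One_nat_def card_1_singletonE card_0_eq finite le_Suc_eq le_zero_eq)
    then show "\<exists>k. set_mset M \<subseteq> line k"
    proof cases
      case 1
      then have "set_mset M = {}" using unique_line assms by (metis (mono_tags, lifting) empty_Collect_eq equals0I)
      then show ?thesis by simp
    next
      case (2 k)
      then have "set_mset M \<subseteq> line k" using unique_line assms
        by (metis (mono_tags, lifting) mem_Collect_eq singletonD subsetI)
      then show ?thesis ..
    qed
  qed
  then have "vec.span (set_mset M) = UNIV \<longleftrightarrow> size (partition_type M) \<ge> 2"
    using span_eq_UNIV_iff[of "set_mset M"] assms by (auto simp: size_partition_type)
  then show ?thesis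
    using assms sum_mset_partition_type[OF assms] by (auto simp: zero_sum_multiset_def)
qed

end

section \<open>Hyperbolic elements\<close>

lemma mult_order_props:
  fixes y :: "'a::{field,finite}"
  assumes "y \<noteq> 0"
  shows "mult_order y > 0" "y ^ mult_order y = 1"
    "inj_on (\<lambda>k. y ^ k) {..<mult_order y}"
    "range (\<lambda>k. y ^ k) = (\<lambda>k. y ^ k) ` {..<mult_order y}"
    "card (range (\<lambda>k. y ^ k)) = mult_order y"
proof -
  let ?f = "mult_order y"
  have cancel: "y ^ (j - i) = 1" if "i < j" "y ^ i = y ^ j" for i j
  proof -
    have "y ^ (i + (j - i)) = y ^ i * y ^ (j - i)"
      by (rule power_add)
    then show ?thesis using that assms by simp
  qed
  \<comment> \<open>Two powers coincide in a finite field; cancelling gives a positive exponent with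
    power 1.\<close>
  have "\<not> inj (\<lambda>k::nat. y ^ k)"
    using range_inj_infinite[of "\<lambda>k::nat. y ^ k"] finite by blast
  then obtain i j :: nat where "i < j" "y ^ i = y ^ j"
    unfolding inj_def by (metis linorder_neqE_nat)
  with cancel have ex: "\<exists>k>0. y ^ k = 1"
    by (intro exI[of _ "j - i"]) auto
  show f: "?f > 0" and yf: "y ^ ?f = 1"
    unfolding mult_order_def using LeastI_ex[OF ex] by auto
  have least: "k = 0" if "k < ?f" "y ^ k = 1" for k
    using that not_less_Least[of k "\<lambda>k. k > 0 \<and> y ^ k = 1"] unfolding mult_order_def by auto
  show inj: "inj_on (\<lambda>k. y ^ k) {..<?f}"
  proof (rule linorder_inj_onI)
    fix i j assume "i < j" "i \<in> {..<?f}" "j \<in> {..<?f}"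
    then have "j - i < ?f" "j - i \<noteq> 0" by auto
    then show "y ^ i \<noteq> y ^ j" using cancel[of i j] least[of "j - i"] \<open>i < j\<close> by auto
  qed auto
  show range: "range (\<lambda>k. y ^ k) = (\<lambda>k. y ^ k) ` {..<?f}"
  proof (intro equalityI subsetI)
    fix x assume "x \<in> range (\<lambda>k. y ^ k)"
    then obtain k where "x = y ^ k" by blast
    also have "\<dots> = y ^ (?f * (k div ?f) + k mod ?f)" by simp
    also have "\<dots> = y ^ (k mod ?f)" by (simp only: power_add power_mult yf power_one mult_1)
    finally show "x \<in> (\<lambda>k. y ^ k) ` {..<?f}" using f by auto
  qed auto
  show "card (range (\<lambda>k. y ^ k)) = ?f"
    using inj by (simp add: range card_image)
qed

lemma mult_order_1 [simp]: "mult_order (1::'a::field) = 1"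
  unfolding mult_order_def by (rule Least_equality) auto

lemma sum_mset_if_eq: "(\<Sum>i\<in>#N. if fst i = k then c else 0) = c * size {#i \<in># N. fst i = k#}"
  for c :: nat
  by (induction N) auto

lemma sum_size_filter_fst:
  "finite L \<Longrightarrow> (\<Sum>k\<in>L. size {#i \<in># N. fst i = k#}) = size {#i \<in># N. fst i \<in> L#}"
proof (induction N)
  case (add i N)
  have "(\<Sum>k\<in>L. size {#j \<in># add_mset i N. fst j = k#}) =
      (\<Sum>k\<in>L. (if k = fst i then 1 else 0) + size {#j \<in># N. fst j = k#})"
    by (rule sum.cong) auto
  then show ?case using add by (simp add: sum.distrib)
qed simp

locale hyperbolic_frame = frame v\<^sub>1 v\<^sub>2 for v\<^sub>1 v\<^sub>2 :: "'a::{field,finite}^2" +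
  fixes \<sigma> :: "'a^2^2" and y :: 'a and f :: nat
  assumes prime_card: "prime (CARD('a))"
    and \<sigma>_v1: "\<sigma> *v v\<^sub>1 = v\<^sub>1" and \<sigma>_v2: "\<sigma> *v v\<^sub>2 = y *s v\<^sub>2"
    and y0: "y \<noteq> 0"
    and f_def: "f = mult_order y" and other_order: "other_order \<sigma> = f"
    and in_class: "\<sigma> \<in> hyperbolic_class f"
begin

definition Y where "Y = range (\<lambda>k. y ^ k)"

text \<open>The choice is made from the coset as a set, so all elements of a coset get the same
  representative.\<close>

definition rep :: "'a \<Rightarrow> 'a" where "rep b = (SOME x. x \<in> (*) b ` Y)"

definition R where "R = rep ` (- {0})"

text \<open>
  A key stands for an orbit of lines: \<open>Some 0\<close> and \<open>None\<close> for the eigenlines of 1 and \<open>y\<close>, and \<open>Some r\<close>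
  for the \<open>f\<close> lines whose slopes form the coset \<open>r Y\<close>.
\<close>

definition keys where "keys = insert None (insert (Some 0) (Some ` R))"

text \<open>\<open>R\<close> serves twice: its elements are the slope cosets in the keys, and for
  the key \<open>None\<close> they label the orbits on the \<open>y\<close>-eigenline, which are
  also cosets of \<open>Y\<close>. For the other keys the label is the first coordinate, which
  \<open>\<sigma>\<close> preserves.\<close>

definition labels :: "'a option \<Rightarrow> 'a set" where
  "labels k = (case k of None \<Rightarrow> R | Some _ \<Rightarrow> - {0})"

definition orb :: "'a option \<times> 'a \<Rightarrow> ('a^2) set" where
  "orb i = (case fst i of None \<Rightarrow> (\<lambda>z. pt 0 (snd i * z)) ` Y
                        | Some r \<Rightarrow> (\<lambda>z. pt (snd i) (snd i * r * z)) ` Y)"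

definition scale :: "'a option \<Rightarrow> 'a" where
  "scale k = (case k of None \<Rightarrow> 0 | Some r \<Rightarrow> if r = 0 then 1 else of_nat f)"

abbreviation "index \<equiv> Sigma keys labels"

abbreviation weight :: "('a option \<times> 'a) multiset \<Rightarrow> 'a" where
  "weight N \<equiv> \<Sum>i\<in>#N. scale (fst i) * snd i"

abbreviation load :: "('a option \<times> 'a) multiset \<Rightarrow> 'a option \<Rightarrow> nat" where
  "load N k \<equiv> size {#i \<in># N. fst i = k#}"

text \<open>The expression that \<open>N\<close> realises. An entry of the third component is the
  load of a whole orbit of lines, which is the number of vectors on each single line of that
  orbit.\<close>

definition shape :: "('a option \<times> 'a) multiset \<Rightarrow> nat \<times> nat \<times> nat multiset" where
  "shape N = (load N (Some 0), load N None,
     filter_mset (\<lambda>k. k \<noteq> 0) (image_mset (\<lambda>r. load N (Some r)) (mset_set R)))"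

lemma f_gt_1: "f > 1"
  using in_class by (simp add: hyperbolic_class_def)

lemma y_neq_1: "y \<noteq> 1"
  using f_gt_1 f_def by auto

section \<open>The group generated by \<open>y\<close> and its cosets\<close>

lemma card_Y: "card Y = f"
  using mult_order_props(5)[OF y0] by (simp add: Y_def f_def)

lemma Y_eq: "Y = (\<lambda>k. y ^ k) ` {..<f}"
  using mult_order_props(4)[OF y0] by (simp add: Y_def f_def)

lemma Y_mult: "z \<in> Y \<Longrightarrow> w \<in> Y \<Longrightarrow> z * w \<in> Y"
  by (auto simp: Y_def simp flip: power_add)

lemma one_Y: "1 \<in> Y"
  unfolding Y_def by (rule range_eqI[of _ _ 0]) simp

lemma Y_nonzero: "z \<in> Y \<Longrightarrow> z \<noteq> 0"
  using y0 by (auto simp: Y_def)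

lemma Y_inverse: "z \<in> Y \<Longrightarrow> inverse z \<in> Y"
proof -
  assume "z \<in> Y"
  then obtain k where k: "k < f" "z = y ^ k" by (auto simp: Y_eq)
  then have "z * y ^ (f - k) = 1"
    using mult_order_props(2)[OF y0] by (simp add: f_def flip: power_add)
  then have "inverse z = y ^ (f - k)" by (metis inverse_unique)
  then show ?thesis by (simp add: Y_def)
qed

text \<open>Multiplication by \<open>y \<noteq> 1\<close> permutes \<open>Y\<close>, so the sum
  equals \<open>y\<close> times itself.\<close>

lemma sum_Y: "\<Sum>Y = 0"
proof -
  have "(\<lambda>z. y * z) ` Y = Y"
  proof (rule card_subset_eq)
    show "(\<lambda>z. y * z) ` Y \<subseteq> Y" by (auto simp: Y_def simp flip: power_Suc)
    show "card ((\<lambda>z. y * z) ` Y) = card Y" by (rule card_image) (auto simp: inj_on_def y0)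
  qed simp
  moreover have "(\<Sum>z\<in>(\<lambda>z. y * z) ` Y. z) = y * \<Sum>Y"
    by (subst sum.reindex) (auto simp: inj_on_def y0 sum_distrib_left)
  ultimately show ?thesis using y_neq_1 by simp
qed

lemma rep_coset:
  obtains z where "z \<in> Y" "rep b * z = b"
proof -
  have "rep b \<in> (*) b ` Y"
    unfolding rep_def by (rule someI[of _ b]) (use one_Y in force)
  then obtain z where "z \<in> Y" "rep b = b * z" by blast
  then show ?thesis
    using that[of "inverse z"] Y_inverse Y_nonzero by (simp add: mult.assoc)
qed

lemma rep_mult: "z \<in> Y \<Longrightarrow> rep (b * z) = rep b"
proof -
  assume z: "z \<in> Y"
  have "(*) (b * z) ` Y = (*) b ` Y"
  proof (intro equalityI subsetI)
    fix x assume "x \<in> (*) b ` Y"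
    then obtain w where "w \<in> Y" "x = b * w" by blast
    then have "x = b * z * (inverse z * w)" using Y_nonzero[OF z] by simp
    then show "x \<in> (*) (b * z) ` Y"
      using Y_mult[OF Y_inverse[OF z] \<open>w \<in> Y\<close>] by blast
  qed (use z Y_mult in \<open>auto simp: mult.assoc\<close>)
  then show ?thesis by (simp add: rep_def)
qed

lemma rep_nonzero: "b \<noteq> 0 \<Longrightarrow> rep b \<noteq> 0"
  by (rule rep_coset[of b]) auto

lemma rep_rep: "rep (rep b) = rep b"
proof -
  obtain z where "z \<in> Y" "rep b * z = b" by (rule rep_coset)
  then show ?thesis using rep_mult[of z "rep b"] by simp
qed

lemma rep_R: "r \<in> R \<Longrightarrow> rep r = r"
  by (auto simp: R_def rep_rep)

lemma R_nonzero: "r \<in> R \<Longrightarrow> r \<noteq> 0"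
  by (auto simp: R_def rep_nonzero)

lemma zero_notin_R [simp]: "0 \<notin> R"
  using R_nonzero by blast

lemma finite_R [simp]: "finite R"
  by (simp add: R_def)

lemma coset_fibre:
  assumes "r \<in> R"
  shows "{b. b \<noteq> 0 \<and> rep b = r} = (*) r ` Y"
proof (intro equalityI subsetI)
  fix b assume "b \<in> {b. b \<noteq> 0 \<and> rep b = r}"
  moreover obtain z where "z \<in> Y" "rep b * z = b" by (rule rep_coset)
  ultimately show "b \<in> (*) r ` Y" by auto
next
  fix b assume "b \<in> (*) r ` Y"
  then show "b \<in> {b. b \<noteq> 0 \<and> rep b = r}"
    using assms R_nonzero Y_nonzero by (auto simp: rep_mult rep_R)
qed

lemma card_coset_fibre: "r \<in> R \<Longrightarrow> card {b. b \<noteq> 0 \<and> rep b = r} = f"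
  by (simp add: coset_fibre card_image inj_on_def R_nonzero card_Y)

text \<open>Every coset has \<open>f\<close> elements. This multiplicity becomes the number of equal
  parts that an orbit of lines contributes to the partition.\<close>

lemma image_mset_rep: "image_mset rep (mset_set (- {0})) = repeat_mset f (mset_set R)"
proof (rule multiset_eqI)
  fix r
  have "count (image_mset rep (mset_set (- {0}))) r = card {b. b \<noteq> 0 \<and> rep b = r}"
  proof -
    have "count (image_mset rep (mset_set (- {0}))) r = (\<Sum>b\<in>rep -` {r} \<inter> - {0}. 1)"
      unfolding count_image_mset by (rule sum.cong) auto
    also have "rep -` {r} \<inter> - {0} = {b. b \<noteq> 0 \<and> rep b = r}" by auto
    finally show ?thesis by simp
  qed
  also have "\<dots> = (if r \<in> R then f else 0)"
  proof (cases "r \<in> R")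
    case False
    then have "{b. b \<noteq> 0 \<and> rep b = r} = {}" unfolding R_def by blast
    then show ?thesis using False by simp
  qed (simp add: card_coset_fibre)
  also have "\<dots> = count (repeat_mset f (mset_set R)) r" by (simp add: count_mset_set')
  finally show "count (image_mset rep (mset_set (- {0}))) r = count (repeat_mset f (mset_set R)) r" .
qed

lemma card_R: "card R = (CARD('a) - 1) div f"
proof -
  have "size (image_mset rep (mset_set (- {0}))) = CARD('a) - 1"
    by (simp add: Compl_eq_Diff_UNIV card_Diff_subset)
  then have "f * card R = CARD('a) - 1"
    by (simp add: image_mset_rep)
  then have "(CARD('a) - 1) div f = (f * card R) div f" by simp
  then show ?thesis using f_gt_1 by simp
qed

text \<open>\<open>Y\<close> consists of non-zero elements, so \<open>1 < f < p\<close>. It follows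
  that all keys other than \<open>None\<close> have a non-zero coefficient in the linear
  equation.\<close>

lemma of_nat_f: "of_nat f \<noteq> (0::'a)"
proof
  assume "of_nat f = (0::'a)"
  then have "CARD('a) dvd f"
    by (simp add: of_nat_eq_0_iff_char_dvd CHAR_prime_card[OF prime_card])
  moreover have "f \<le> card (- {0::'a})"
    unfolding card_Y[symmetric] using Y_nonzero by (intro card_mono) auto
  then have "f \<le> CARD('a) - 1"
    by (simp add: Compl_eq_Diff_UNIV card_Diff_subset)
  then have "f < CARD('a)"
    using prime_gt_0_nat[OF prime_card] by linarith
  ultimately show False using f_gt_1 by (auto dest: dvd_imp_le)
qed

section \<open>Orbits of \<open>\<sigma>\<close> on the non-zero vectors\<close>

lemma \<sigma>_pt: "\<sigma> *v pt a b = pt a (y * b)"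
  by (simp add: pt_def vec.add vec.scale \<sigma>_v1 \<sigma>_v2 vec.scale_scale mult.commute)

lemma \<sigma>_pow_pt: "(((*v) \<sigma>) ^^ k) (pt a b) = pt a (y ^ k * b)"
  by (induction k) (simp_all add: \<sigma>_pt mult.assoc)

lemma bij_\<sigma>: "bij ((*v) \<sigma>)"
proof -
  have "inj ((*v) \<sigma>)"
  proof (rule injI)
    fix u v assume "\<sigma> *v u = \<sigma> *v v"
    then show "u = v"
      by (cases u rule: pt_exhaust; cases v rule: pt_exhaust) (simp add: \<sigma>_pt y0)
  qed
  then show ?thesis by (simp add: bij_def finite_UNIV_inj_surj)
qed

lemma orb_simps:
  "orb (None, x) = (\<lambda>z. pt 0 (x * z)) ` Y"
  "orb (Some r, x) = (\<lambda>z. pt x (x * r * z)) ` Y"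
  by (simp_all add: orb_def)

lemma index_cases:
  assumes "i \<in> index"
  obtains r where "i = (None, r)" "r \<in> R"
    | a where "i = (Some 0, a)" "a \<noteq> 0"
    | r a where "i = (Some r, a)" "r \<in> R" "a \<noteq> 0"
  using assms by (auto simp: keys_def labels_def)

lemma finite_keys [simp]: "finite keys"
  by (simp add: keys_def)

lemma finite_index: "finite index"
  by (rule finite_subset[OF subset_UNIV]) simp

lemma orb_range: "\<exists>b. orb i = range (\<lambda>k. (((*v) \<sigma>) ^^ k) b)"
proof (cases i)
  case (Pair k x)
  show ?thesis
  proof (cases k)
    case None
    have "orb i = range (\<lambda>k. (((*v) \<sigma>) ^^ k) (pt 0 x))"
      unfolding Pair None orb_simps \<sigma>_pow_pt Y_def image_image by (simp only: mult.commute[of x])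
    then show ?thesis ..
  next
    case (Some r)
    have "orb i = range (\<lambda>k. (((*v) \<sigma>) ^^ k) (pt x (x * r)))"
      unfolding Pair Some orb_simps \<sigma>_pow_pt Y_def image_image by (simp only: mult.commute[of "x * r"])
    then show ?thesis ..
  qed
qed

lemma orb_finite: "finite (orb i)"
  by (rule finite_subset[OF subset_UNIV]) simp

definition index_of :: "'a \<Rightarrow> 'a \<Rightarrow> 'a option \<times> 'a" where
  "index_of a b = (if a = 0 then (None, rep b)
     else if b = 0 then (Some 0, a) else (Some (rep (b / a)), a))"

lemma rep_in_R: "b \<noteq> 0 \<Longrightarrow> rep b \<in> R"
  by (simp add: R_def)

text \<open>\<open>\<sigma>\<close> fixes \<open>a\<close> and multiplies \<open>b\<close> by
  \<open>y\<close>. So \<open>a\<close> together with the coset of \<open>b / a\<close>, or of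
  \<open>b\<close> when \<open>a = 0\<close>, is a complete invariant of the orbit; covering and
  disjointness are read off from it.\<close>

lemma pt_in_orb:
  assumes "i \<in> index"
  shows "pt a b \<in> orb i \<longleftrightarrow> (a \<noteq> 0 \<or> b \<noteq> 0) \<and> i = index_of a b"
proof
  assume mem: "pt a b \<in> orb i"
  from assms show "(a \<noteq> 0 \<or> b \<noteq> 0) \<and> i = index_of a b"
  proof (cases rule: index_cases)
    case (1 r)
    then show ?thesis using mem R_nonzero Y_nonzero by (auto simp: orb_simps index_of_def rep_mult rep_R)
  next
    case (2 x)
    then show ?thesis using mem by (auto simp: orb_simps index_of_def)
  next
    case (3 r x)
    then obtain z where z: "z \<in> Y" "a = x" "b = x * r * z" using mem by (auto simp: orb_simps)
    then have "b / a = r * z" "b \<noteq> 0" using 3 R_nonzero Y_nonzero by auto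
    then show ?thesis using 3 z by (auto simp: index_of_def rep_mult rep_R)
  qed
next
  assume *: "(a \<noteq> 0 \<or> b \<noteq> 0) \<and> i = index_of a b"
  consider "a = 0" "b \<noteq> 0" | "a \<noteq> 0" "b = 0" | "a \<noteq> 0" "b \<noteq> 0" using * by blast
  then show "pt a b \<in> orb i"
  proof cases
    case 1
    obtain z where "z \<in> Y" "rep b * z = b" by (rule rep_coset)
    then show ?thesis using 1 * by (auto simp: index_of_def orb_simps image_iff intro!: bexI[of _ z])
  next
    case 2
    then show ?thesis using * one_Y by (auto simp: index_of_def orb_simps image_iff)
  next
    case 3
    obtain z where z: "z \<in> Y" "rep (b / a) * z = b / a" by (rule rep_coset)
    then have "a * rep (b / a) * z = b" using 3 by (simp add: mult.assoc)
    then show ?thesis using 3 * z by (auto simp: index_of_def orb_simps image_iff intro!: bexI[of _ z])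
  qed
qed

lemma index_of_in_index: "a \<noteq> 0 \<or> b \<noteq> 0 \<Longrightarrow> index_of a b \<in> index"
  by (auto simp: index_of_def keys_def labels_def rep_in_R)

lemma Union_orb: "(\<Union>i\<in>index. orb i) = - {0}"
proof (intro equalityI subsetI)
  fix v assume "v \<in> (\<Union>i\<in>index. orb i)"
  then obtain i where i: "i \<in> index" "v \<in> orb i" by blast
  obtain a b where "v = pt a b" by (rule pt_exhaust)
  then show "v \<in> - {0}" using i pt_in_orb[OF i(1), of a b] by auto
next
  fix v :: "'a^2" assume v: "v \<in> - {0}"
  obtain a b where ab: "v = pt a b" by (rule pt_exhaust)
  then have nz: "a \<noteq> 0 \<or> b \<noteq> 0" using v by auto
  have "v \<in> orb (index_of a b)"
    unfolding ab pt_in_orb[OF index_of_in_index[OF nz]] using nz by blast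
  then show "v \<in> (\<Union>i\<in>index. orb i)"
    using index_of_in_index[OF nz] by (rule UN_I[rotated])
qed

lemma disjoint_orb: "disjoint_family_on orb index"
  unfolding disjoint_family_on_def
proof (intro ballI impI)
  fix i j assume ij: "i \<in> index" "j \<in> index" "i \<noteq> j"
  show "orb i \<inter> orb j = {}"
  proof (intro equalityI subsetI)
    fix v assume v: "v \<in> orb i \<inter> orb j"
    obtain a b where "v = pt a b" by (rule pt_exhaust)
    then have "i = index_of a b" "j = index_of a b"
      using v pt_in_orb[OF ij(1), of a b] pt_in_orb[OF ij(2), of a b] by simp_all
    then show "v \<in> {}" using ij by simp
  qed simp
qed

lemma bij_betw_tiled_orb:
  "bij_betw (tiled orb) {N. set_mset N \<subseteq> index} {M. 0 \<notin># M \<and> image_mset ((*v) \<sigma>) M = M}"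
proof -
  have "bij_betw (tiled orb) {N. set_mset N \<subseteq> index}
     {M. set_mset M \<subseteq> (\<Union>i\<in>index. orb i) \<and> image_mset ((*v) \<sigma>) M = M}"
  proof (rule bij_betw_tiled[OF bij_\<sigma> finite_index orb_finite disjoint_orb orb_range])
    fix v assume "\<sigma> *v v \<in> (\<Union>i\<in>index. orb i)"
    then show "v \<in> (\<Union>i\<in>index. orb i)" by (auto simp: Union_orb)
  qed
  then show ?thesis by (auto simp: Union_orb)
qed

text \<open>Second coordinates run through a multiple of \<open>Y\<close> or are 0, and cancel by
  \<open>sum_Y\<close>; the constant first coordinate is counted once per vector.\<close>

lemma sum_orb:
  assumes "i \<in> index"
  shows "\<Sum>(orb i) = pt (scale (fst i) * snd i) 0"
  using assms
proof (cases rule: index_cases)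
  case (1 r)
  then have "\<Sum>(orb i) = (\<Sum>z\<in>Y. pt 0 (r * z))"
    using R_nonzero by (simp add: orb_simps sum.reindex inj_on_def)
  then show ?thesis
    using 1 sum_Y by (simp add: sum_pt scale_def flip: sum_distrib_left)
next
  case (2 a)
  then have "orb i = {pt a 0}" using one_Y by (auto simp: orb_simps)
  then show ?thesis using 2 by (simp add: scale_def)
next
  case (3 r a)
  then have "\<Sum>(orb i) = (\<Sum>z\<in>Y. pt a (a * r * z))"
    using R_nonzero by (simp add: orb_simps sum.reindex inj_on_def)
  then show ?thesis
    using 3 sum_Y R_nonzero by (auto simp: sum_pt scale_def card_Y simp flip: sum_distrib_left)
qed

lemma sum_mset_tiled_orb:
  assumes "set_mset N \<subseteq> index"
  shows "sum_mset (tiled orb N) = pt (weight N) 0"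
proof -
  have "sum_mset (tiled orb N) = (\<Sum>i\<in>#N. pt (scale (fst i) * snd i) 0)"
    unfolding sum_mset_tiled using assms sum_orb by (intro arg_cong[where f = sum_mset] image_mset_cong) auto
  then show ?thesis by (simp add: sum_mset_pt)
qed

text \<open>An orbit on the \<open>y\<close>-eigenline stays on it with all its \<open>f\<close>
  vectors, one on the other eigenline is a fixed point, and any other orbit has exactly one vector
  on each line with slope in its coset.\<close>

lemma card_orb_line:
  assumes "i \<in> index"
  shows "card {v \<in> orb i. v \<in> line None} = (if fst i = None then f else 0)"
    "card {v \<in> orb i. v \<in> line (Some 0)} = (if fst i = Some 0 then 1 else 0)"
    "t \<noteq> 0 \<Longrightarrow> card {v \<in> orb i. v \<in> line (Some t)} = (if fst i = Some (rep t) then 1 else 0)"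
proof -
  show "card {v \<in> orb i. v \<in> line None} = (if fst i = None then f else 0)"
    using assms
  proof (cases rule: index_cases)
    case (1 r)
    then have "{v \<in> orb i. v \<in> line None} = (\<lambda>z. pt 0 (r * z)) ` Y"
      by (auto simp: orb_simps)
    then show ?thesis using 1 R_nonzero by (simp add: card_image inj_on_def card_Y)
  next
    case (2 a)
    then have "{v \<in> orb i. v \<in> line None} = {}" by (auto simp: orb_simps)
    then show ?thesis using 2 by simp
  next
    case (3 r a)
    then have "{v \<in> orb i. v \<in> line None} = {}" by (auto simp: orb_simps)
    then show ?thesis using 3 by simp
  qed
  show "card {v \<in> orb i. v \<in> line (Some 0)} = (if fst i = Some 0 then 1 else 0)"
    using assms
  proof (cases rule: index_cases)
    case (1 r)
    then have "{v \<in> orb i. v \<in> line (Some 0)} = {}"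
      using R_nonzero Y_nonzero by (auto simp: orb_simps)
    then show ?thesis using 1 by (simp only: card.empty) simp
  next
    case (2 a)
    then have "{v \<in> orb i. v \<in> line (Some 0)} = {pt a 0}" using one_Y by (auto simp: orb_simps)
    then show ?thesis using 2 by simp
  next
    case (3 r a)
    then have "{v \<in> orb i. v \<in> line (Some 0)} = {}"
      using R_nonzero Y_nonzero by (auto simp: orb_simps)
    then show ?thesis using 3 R_nonzero by (simp only: card.empty) auto
  qed
  assume t: "t \<noteq> 0"
  show "card {v \<in> orb i. v \<in> line (Some t)} = (if fst i = Some (rep t) then 1 else 0)"
    using assms
  proof (cases rule: index_cases)
    case (1 r)
    then have "{v \<in> orb i. v \<in> line (Some t)} = {}"
      using R_nonzero Y_nonzero by (auto simp: orb_simps)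
    then show ?thesis using 1 by (simp only: card.empty) simp
  next
    case (2 a)
    then have "{v \<in> orb i. v \<in> line (Some t)} = {}" using t by (auto simp: orb_simps)
    then show ?thesis using 2 rep_nonzero[OF t] by (simp only: card.empty) auto
  next
    case (3 r a)
    have eq: "v \<in> orb i \<and> v \<in> line (Some t) \<longleftrightarrow> v = pt a (a * t) \<and> r = rep t" for v
    proof -
      obtain c d where v: "v = pt c d" by (rule pt_exhaust)
      show ?thesis
        unfolding v pt_in_orb[OF assms] using 3 t by (auto simp: index_of_def)
    qed
    then have "{v \<in> orb i. v \<in> line (Some t)} = (if r = rep t then {pt a (a * t)} else {})"
      by auto
    then show ?thesis using 3 by simp
  qed
qed

section \<open>Partition types and feasibility of unions of orbits\<close>

lemma on_line_tiled_orb: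
  assumes "set_mset N \<subseteq> index"
  shows "on_line (tiled orb N) None = f * load N None"
    "on_line (tiled orb N) (Some 0) = load N (Some 0)"
    "t \<noteq> 0 \<Longrightarrow> on_line (tiled orb N) (Some t) = load N (Some (rep t))"
proof -
  have *: "on_line (tiled orb N) k = c * load N k'"
    if "\<And>i. i \<in> index \<Longrightarrow> card {v \<in> orb i. v \<in> line k} = (if fst i = k' then c else 0)" for k k' c
  proof -
    have "on_line (tiled orb N) k = (\<Sum>i\<in>#N. card {v \<in> orb i. v \<in> line k})"
      by (rule size_filter_tiled) (simp add: orb_finite)
    also have "\<dots> = (\<Sum>i\<in>#N. if fst i = k' then c else 0)"
      using assms that by (intro arg_cong[where f = sum_mset] image_mset_cong) blast
    finally show ?thesis by (simp add: sum_mset_if_eq)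
  qed
  show "on_line (tiled orb N) None = f * load N None"
    using card_orb_line(1) by (rule *)
  show "on_line (tiled orb N) (Some 0) = load N (Some 0)"
    using *[OF card_orb_line(2)] by simp
  show "on_line (tiled orb N) (Some t) = load N (Some (rep t))" if "t \<noteq> 0"
    using *[OF card_orb_line(3)[OF _ that]] by simp
qed

lemma class_facts:
  "hyperbolic \<sigma>" "\<not> parabolic \<sigma>" "central_indicator \<sigma> = f" "central_quotient \<sigma> = 1"
  "o_num \<sigma> = card R"
  using in_class by (auto simp: hyperbolic_class_def parabolic_def hyperbolic_def o_num_def card_R)

lemma expr_partition_eq:
  "expr_partition \<sigma> (l, n, B) =
     filter_mset (\<lambda>k. k \<noteq> 0) ({#l, f * n#} + repeat_mset f B)"
  by (simp add: expr_partition_def class_facts other_order mult.commute)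

lemma filter_repeat_mset:
  "filter_mset Q (repeat_mset n (filter_mset Q A)) = filter_mset Q (repeat_mset n A)"
  by (simp add: multiset_eq_iff)

lemma partition_type_tiled_orb:
  assumes "set_mset N \<subseteq> index"
  shows "partition_type (tiled orb N) = expr_partition \<sigma> (shape N)"
proof -
  have UNIV_eq: "UNIV = insert None (insert (Some 0) (Some ` (- {0::'a})))"
    by (auto simp: image_iff)
  have "mset_set UNIV = {#None, Some 0#} + image_mset Some (mset_set (- {0::'a}))"
  proof -
    have "image_mset Some (mset_set (- {0::'a})) = mset_set (Some ` (- {0}))"
      by (rule image_mset_mset_set) simp
    then show ?thesis unfolding UNIV_eq by (simp add: image_iff)
  qed
  then have "image_mset (on_line (tiled orb N)) (mset_set UNIV) =
      {#f * load N None, load N (Some 0)#} +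
      image_mset (\<lambda>t. on_line (tiled orb N) (Some t)) (mset_set (- {0}))"
    by (simp add: on_line_tiled_orb[OF assms] multiset.map_comp o_def)
  also have "image_mset (\<lambda>t. on_line (tiled orb N) (Some t)) (mset_set (- {0})) =
      image_mset (\<lambda>t. load N (Some (rep t))) (mset_set (- {0}))"
    by (rule image_mset_cong) (simp add: on_line_tiled_orb[OF assms])
  also have "\<dots> = image_mset (\<lambda>r. load N (Some r)) (image_mset rep (mset_set (- {0})))"
    by (simp add: multiset.map_comp o_def)
  also have "\<dots> = repeat_mset f (image_mset (\<lambda>r. load N (Some r)) (mset_set R))"
    unfolding image_mset_rep by (induction f) auto
  finally show ?thesis
    by (simp only: partition_type_eq shape_def expr_partition_eq filter_union_mset filter_repeat_mset
        add_mset_commute[of "load N (Some 0)"])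
qed

text \<open>A single orbit off the \<open>y\<close>-eigenline would leave a non-zero first
  coordinate in the total sum. This is the source of the condition \<open>l \<noteq> 1\<close> in
  the notion of feasibility.\<close>

lemma weight_0_imp_load:
  assumes N: "set_mset N \<subseteq> index" "weight N = 0" and shape: "shape N = (l, n, B)"
  shows "l + sum_mset B \<noteq> 1"
proof
  assume sum1: "l + sum_mset B = 1"
  define A where "A = {#i \<in># N. fst i \<noteq> None#}"
  have "sum_mset (filter_mset (\<lambda>k. k \<noteq> 0) Q) = sum_mset Q" for Q :: "nat multiset"
    by (induction Q) auto
  then have "sum_mset B = (\<Sum>r\<in>R. load N (Some r))"
    using shape by (auto simp: shape_def sum_unfold_sum_mset)
  then have "l + sum_mset B = (\<Sum>k\<in>insert (Some 0) (Some ` R). load N k)"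
    using shape by (subst sum.insert) (auto simp: shape_def sum.reindex)
  also have "\<dots> = size {#i \<in># N. fst i \<in> insert (Some 0) (Some ` R)#}"
    by (rule sum_size_filter_fst) simp
  also have "{#i \<in># N. fst i \<in> insert (Some 0) (Some ` R)#} = A"
    unfolding A_def
  proof (rule filter_mset_cong[OF refl])
    fix i assume "i \<in># N"
    then have "i \<in> index" using N by blast
    then show "fst i \<in> insert (Some 0) (Some ` R) \<longleftrightarrow> fst i \<noteq> None"
      by (cases rule: index_cases) auto
  qed
  finally have "size A = 1" using sum1 by simp
  then obtain i where A: "A = {#i#}" using size_1_singleton_mset by blast
  then have "i \<in># A" by simp
  then have i: "i \<in># N" "fst i \<noteq> None" unfolding A_def by auto
  have "weight N = weight (A + {#i \<in># N. \<not> fst i \<noteq> None#})"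
    unfolding A_def by (subst multiset_partition[of N "\<lambda>i. fst i \<noteq> None"]) (rule refl)
  also have "\<dots> = weight A + weight {#i \<in># N. \<not> fst i \<noteq> None#}"
    by simp
  also have "weight {#i \<in># N. \<not> fst i \<noteq> None#} = 0"
    by (rule sum_mset.neutral) (auto simp: scale_def)
  finally have "scale (fst i) * snd i = 0" using N A by simp
  moreover have "i \<in> index" using i N by blast
  then have "scale (fst i) * snd i \<noteq> 0"
    using i(2) of_nat_f by (cases rule: index_cases) (auto simp: scale_def)
  ultimately show False by contradiction
qed

text \<open>If \<open>B\<close> is empty, two parts mean \<open>l, n > 0\<close>, and
  \<open>l \<noteq> 1\<close> comes from \<open>weight_0_imp_load\<close>. If \<open>B\<close> is
  non-empty, one orbit of lines already gives \<open>f \<ge> 2\<close> parts; their sum could be as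
  small as 2 only for \<open>f = 2\<close>, \<open>l = n = 0\<close> and \<open>B = {#1#}\<close>,
  which the same lemma excludes.\<close>

lemma feasible_shape_iff:
  assumes N: "set_mset N \<subseteq> index" "weight N = 0"
  shows "feasible \<sigma> (shape N) \<longleftrightarrow>
    sum_mset (expr_partition \<sigma> (shape N)) \<ge> 3 \<and> size (expr_partition \<sigma> (shape N)) \<ge> 2"
proof -
  obtain l n B where shape: "shape N = (l, n, B)" by (cases "shape N")
  have B: "0 \<notin># B" "size B \<le> card R"
    using shape by (auto simp: shape_def intro: order_trans[OF size_filter_mset_lesseq])
  have feas: "feasible \<sigma> (l, n, B) \<longleftrightarrow> (B = {#} \<longrightarrow> l > 0 \<and> n > 0 \<and> l \<noteq> 1)"
    using B in_class by (auto simp: feasible_def class_facts)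
  have l: "l + sum_mset B \<noteq> 1" using weight_0_imp_load[OF N shape] .
  have "filter_mset (\<lambda>k. k \<noteq> 0) (repeat_mset f B) = repeat_mset f B"
    using B f_gt_1 by (auto simp: multiset_eq_iff not_in_iff)
  then have part: "expr_partition \<sigma> (l, n, B) =
      filter_mset (\<lambda>k. k \<noteq> 0) {#l, f * n#} + repeat_mset f B"
    by (simp only: expr_partition_eq filter_union_mset)
  have sum_repeat: "sum_mset (repeat_mset f B) = f * sum_mset B"
    by (induction f) auto
  have sum_part: "sum_mset (expr_partition \<sigma> (l, n, B)) = l + f * n + f * sum_mset B"
    unfolding part by (auto simp: sum_repeat)
  have size_part: "size (expr_partition \<sigma> (l, n, B)) =
      (if l = 0 then 0 else 1) + (if n = 0 then 0 else 1) + f * size B"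
    using f_gt_1 unfolding part by auto
  have fn: "f * n \<ge> 2 * n" "f * sum_mset B \<ge> 2 * sum_mset B" "f * size B \<ge> 2 * size B"
    using f_gt_1 by auto
  \<comment> \<open>The products become opaque, which leaves linear goals. Here \<open>y\<close> is
    \<open>f * sum_mset B\<close>, not the eigenvalue.\<close>
  define x y z where "x = f * n" and "y = f * sum_mset B" and "z = f * size B"
  note fn = fn[folded x_def y_def z_def]
    and sum_part = sum_part[folded x_def y_def] and size_part = size_part[folded z_def]
  show ?thesis
  proof (cases "B = {#}")
    case True
    then have "y = 0" "z = 0" "sum_mset B = 0" by (auto simp: y_def z_def)
    then show ?thesis using fn l True unfolding shape feas sum_part size_part by auto
  next
    case False
    then obtain q where "q \<in># B" by blast
    then have "sum_mset B \<ge> 1" using B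
      by (metis One_nat_def Suc_leI gr0I sum_mset_0_iff)
    moreover have "size B \<ge> 1" using False by (simp add: Suc_leI nonempty_has_size)
    ultimately show ?thesis
      using fn l False unfolding shape feas sum_part size_part by auto
  qed
qed

text \<open>Among solutions of \<open>weight N = 0\<close>, the size and spanning conditions are
  exchanged for feasibility by \<open>feasible_shape_iff\<close>. This brings the count into the
  form of a union over expressions.\<close>

lemma Fix_eq:
  "Fix P \<sigma> = tiled orb ` {N. set_mset N \<subseteq> index \<and> weight N = 0 \<and> shape N \<in> feasible_expressions \<sigma> P}"
    (is "_ = _ ` ?S")
proof -
  have iff: "tiled orb N \<in> Fix P \<sigma> \<longleftrightarrow> N \<in> ?S" if N: "set_mset N \<subseteq> index" for N
  proof -
    have inv: "0 \<notin># tiled orb N" "image_mset ((*v) \<sigma>) (tiled orb N) = tiled orb N"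
      using bij_betw_apply[OF bij_betw_tiled_orb, of N] N by auto
    have "sum_mset (tiled orb N) = 0 \<longleftrightarrow> weight N = 0"
      by (simp only: sum_mset_tiled_orb[OF N] pt_eq_0_iff simp_thms)
    then have "tiled orb N \<in> Fix P \<sigma> \<longleftrightarrow> weight N = 0 \<and>
        sum_mset (expr_partition \<sigma> (shape N)) \<ge> 3 \<and> size (expr_partition \<sigma> (shape N)) \<ge> 2 \<and>
        expr_partition \<sigma> (shape N) = P"
      using inv by (simp only: Fix_def multisets_of_type_def mem_Collect_eq
          zero_sum_multiset_iff[OF inv(1)] partition_type_tiled_orb[OF N]) blast
    then show ?thesis
      using feasible_shape_iff[OF N] N unfolding feasible_expressions_def by blast
  qed
  show ?thesis
  proof (intro equalityI subsetI)
    fix M assume M: "M \<in> Fix P \<sigma>"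
    then have "0 \<notin># M" "image_mset ((*v) \<sigma>) M = M"
      by (auto simp: Fix_def multisets_of_type_def zero_sum_multiset_def)
    then obtain N where "set_mset N \<subseteq> index" "M = tiled orb N"
      using bij_betw_imp_surj_on[OF bij_betw_tiled_orb] by (metis (mono_tags, lifting) imageE mem_Collect_eq)
    then show "M \<in> tiled orb ` ?S" using iff M by blast
  next
    fix M assume "M \<in> tiled orb ` ?S"
    then show "M \<in> Fix P \<sigma>" using iff by blast
  qed
qed

section \<open>Counting by shape\<close>

definition extend_load :: "nat \<Rightarrow> nat \<Rightarrow> ('a \<Rightarrow> nat) \<Rightarrow> 'a option \<Rightarrow> nat" where
  "extend_load l n s k = (case k of None \<Rightarrow> n | Some t \<Rightarrow> if t = 0 then l else s t)"

lemma finite_fibre: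
  "finite {N \<in> families keys labels s. weight N = 0}"
  by (rule finite_subset[OF _ finite_families[of keys labels s]]) auto

text \<open>The multisets are split by the function \<open>s\<close> giving the actual load of each
  orbit of lines. The number of such functions is \<open>O_num\<close>, and every fibre has the same
  size: the free key \<open>None\<close> gives the binomial coefficient, all other keys give
  \<open>W_num\<close>.\<close>

lemma card_shape:
  assumes E: "0 \<notin># B" "size B \<le> card R"
  shows "finite {N. set_mset N \<subseteq> index \<and> weight N = 0 \<and> shape N = (l, n, B)}" (is "finite ?A")
    "real (card {N. set_mset N \<subseteq> index \<and> weight N = 0 \<and> shape N = (l, n, B)}) =
       hyperbolic_count \<sigma> f (l, n, B)"
proof -
  let ?S = "{s \<in> R \<rightarrow>\<^sub>E UNIV. filter_mset (\<lambda>k. k \<noteq> 0) (image_mset s (mset_set R)) = B}"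
  let ?F = "\<lambda>s. {N \<in> families keys labels (extend_load l n s). weight N = 0}"
  have p1: "CARD('a) > 1" using prime_gt_1_nat[OF prime_card] .
  \<comment> \<open>The codomain is infinite, so finiteness of \<open>?S\<close> is inferred from
    its non-zero cardinality.\<close>
  have "card ?S \<noteq> 0"
  proof -
    have "real (card ?S) \<noteq> 0"
      unfolding card_functions_with_nonzero_image_mset[OF finite_R E] by simp
    then show ?thesis by simp
  qed
  then have fin: "finite ?S" by (rule card_ge_0_finite[OF neq0_conv[THEN iffD1]])
  have A_eq: "?A = (\<Union>s\<in>?S. ?F s)"
  proof (intro equalityI subsetI)
    fix N assume N: "N \<in> ?A"
    define s where "s = (\<lambda>r\<in>R. load N (Some r))"
    have "image_mset s (mset_set R) = image_mset (\<lambda>r. load N (Some r)) (mset_set R)"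
      by (rule image_mset_cong) (simp add: s_def)
    then have "s \<in> ?S" using N by (simp add: s_def shape_def)
    moreover have "load N k = extend_load l n s k" if "k \<in> keys" for k
      using N that by (auto simp: extend_load_def keys_def shape_def s_def)
    then have "N \<in> ?F s" using N by (simp add: families_def)
    ultimately show "N \<in> (\<Union>s\<in>?S. ?F s)" by blast
  next
    fix N assume "N \<in> (\<Union>s\<in>?S. ?F s)"
    then obtain s where s: "s \<in> ?S" and N: "N \<in> ?F s" by blast
    have load: "load N k = extend_load l n s k" if "k \<in> keys" for k
      using N that by (simp add: families_def)
    have "image_mset (\<lambda>r. load N (Some r)) (mset_set R) = image_mset s (mset_set R)"
    proof (rule image_mset_cong)
      fix r assume "r \<in># mset_set R"
      then have "r \<in> R" by simp
      then show "load N (Some r) = s r"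
        using load[of "Some r"] R_nonzero by (auto simp: keys_def extend_load_def)
    qed
    moreover have "load N (Some 0) = l" "load N None = n"
      using load[of "Some 0"] load[of None] by (auto simp: keys_def extend_load_def)
    ultimately show "N \<in> ?A"
      using s N by (simp add: families_def shape_def)
  qed
  show "finite ?A"
    unfolding A_eq using fin finite_fibre by blast
  have disj: "?F s \<inter> ?F s' = {}" if "s \<in> ?S" "s' \<in> ?S" "s \<noteq> s'" for s s'
  proof (rule ccontr)
    assume "?F s \<inter> ?F s' \<noteq> {}"
    then obtain N where N: "N \<in> ?F s" "N \<in> ?F s'" by blast
    have "s r = s' r" if "r \<in> R" for r
    proof -
      have "Some r \<in> keys" using that by (simp add: keys_def)
      then have "extend_load l n s (Some r) = load N (Some r)" "extend_load l n s' (Some r) = load N (Some r)"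
        using N by (auto simp: families_def)
      then show ?thesis using R_nonzero[OF that] by (simp add: extend_load_def)
    qed
    then have "s = s'" using that(1,2) by (auto intro: PiE_ext)
    then show False using that(3) by contradiction
  qed
  have card_F: "real (card (?F s)) =
      real ((n + (CARD('a) - 1) div f - 1) choose n) * W_num (CARD('a)) (add_mset l B)"
    if s: "s \<in> ?S" for s
  proof -
    let ?K1 = "insert (Some 0) (Some ` R)"
    have keys: "keys - ?K1 = {None}" "?K1 \<subseteq> keys" by (auto simp: keys_def)
    have "real (card (?F s)) =
      (\<Prod>k\<in>keys - ?K1. real ((card (labels k) + extend_load l n s k - 1) choose extend_load l n s k)) *
      W_num (CARD('a)) (image_mset (extend_load l n s) (mset_set ?K1))"
    proof (rule card_families_zero_sum[OF prime_card finite_keys keys(2)])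
      fix k assume "k \<in> ?K1"
      then show "labels k = - {0}" "scale k \<noteq> 0"
        using of_nat_f by (auto simp: labels_def scale_def split: if_splits)
    next
      fix k assume "k \<in> keys - ?K1"
      then show "scale k = 0" using keys by (simp add: scale_def)
    qed
    also have "image_mset (extend_load l n s) (mset_set ?K1) = add_mset l (image_mset s (mset_set R))"
    proof -
      have "mset_set (Some ` R) = image_mset Some (mset_set R)"
        by (rule image_mset_mset_set[symmetric]) simp
      moreover have "Some 0 \<notin> Some ` R" by auto
      moreover have "image_mset (\<lambda>r. extend_load l n s (Some r)) (mset_set R) = image_mset s (mset_set R)"
        by (rule image_mset_cong) (use R_nonzero in \<open>auto simp: extend_load_def\<close>)
      ultimately show ?thesis
        by (simp add: multiset.map_comp o_def) (simp add: extend_load_def)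
    qed
    also have "W_num (CARD('a)) (add_mset l (image_mset s (mset_set R))) = W_num (CARD('a)) (add_mset l B)"
    proof -
      \<comment> \<open>All zeros are dropped on both sides, including \<open>l\<close> when it is
        0.\<close>
      have "filter_mset (\<lambda>k. k \<noteq> 0) (add_mset l (image_mset s (mset_set R))) =
          filter_mset (\<lambda>k. k \<noteq> 0) (add_mset l B)"
      proof -
        have "filter_mset (\<lambda>k. k \<noteq> 0) B = B"
          using E(1) by (simp add: multiset_eq_iff not_in_iff)
        moreover have "filter_mset (\<lambda>k. k \<noteq> 0) (image_mset s (mset_set R)) = B"
          using s by blast
        ultimately show ?thesis by (simp only: filter_mset_add_mset)
      qed
      then show ?thesis by (metis W_num_add_zeros[OF p1])
    qed
    also have "(\<Prod>k\<in>keys - ?K1. real ((card (labels k) + extend_load l n s k - 1) choose extend_load l n s k)) =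
        real ((n + (CARD('a) - 1) div f - 1) choose n)"
      unfolding keys(1) by (simp add: labels_def extend_load_def card_R add.commute)
    finally show ?thesis .
  qed
  have "card ?A = (\<Sum>s\<in>?S. card (?F s))"
    unfolding A_eq using fin finite_fibre disj by (intro card_UN_disjoint) blast+
  then have "real (card ?A) = (\<Sum>s\<in>?S. real (card (?F s)))" by simp
  also have "\<dots> = real (card ?S) *
      (real ((n + (CARD('a) - 1) div f - 1) choose n) * W_num (CARD('a)) (add_mset l B))"
    using card_F by simp
  also have "\<dots> = hyperbolic_count \<sigma> f (l, n, B)"
    unfolding card_functions_with_nonzero_image_mset[OF finite_R E]
    by (simp add: hyperbolic_count_def O_num_def class_facts(5))
  finally show "real (card ?A) = hyperbolic_count \<sigma> f (l, n, B)" .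
qed

lemma feasible_bounds:
  assumes "feasible \<sigma> (l, n, B)"
  shows "0 \<notin># B" "size B \<le> card R"
  using assms by (auto simp: feasible_def class_facts)

text \<open>\<open>l\<close> and \<open>f * n\<close> are bounded by the sum of \<open>P\<close>,
  and each entry of \<open>B\<close> occurs at least \<open>f\<close> times as often in
  \<open>P\<close>. Finiteness allows the cardinality of the disjoint union over expressions to be
  summed.\<close>

lemma finite_feasible_expressions: "finite (feasible_expressions \<sigma> P)"
proof (rule finite_subset)
  show "feasible_expressions \<sigma> P \<subseteq> {..sum_mset P} \<times> {..sum_mset P} \<times> {B. B \<subseteq># P}"
  proof
    fix E assume E: "E \<in> feasible_expressions \<sigma> P"
    obtain l n B where lnB: "E = (l, n, B)" by (cases E)
    with E have "P = expr_partition \<sigma> (l, n, B)" and B: "0 \<notin># B"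
      using feasible_bounds(1) by (auto simp: feasible_expressions_def)
    then have P: "P = filter_mset (\<lambda>k. k \<noteq> 0) {#l, f * n#} + filter_mset (\<lambda>k. k \<noteq> 0) (repeat_mset f B)"
      by (simp only: expr_partition_eq filter_union_mset)
    have "sum_mset P \<ge> l + f * n" unfolding P by auto
    moreover from this have "n \<le> sum_mset P"
      using f_gt_1 mult_le_mono1[of 1 f n] by linarith
    moreover have "B \<subseteq># P"
    proof (rule mset_subset_eqI)
      fix a
      show "count B a \<le> count P a"
      proof (cases "a = 0")
        case False
        have "count B a \<le> f * count B a" using f_gt_1 by simp
        also have "\<dots> = count (filter_mset (\<lambda>k. k \<noteq> 0) (repeat_mset f B)) a"
          using False by simp
        also have "\<dots> \<le> count P a"
          unfolding P count_union by (rule le_add2)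
        finally show ?thesis .
      qed (use B in \<open>simp add: not_in_iff\<close>)
    qed
    ultimately show "E \<in> {..sum_mset P} \<times> {..sum_mset P} \<times> {B. B \<subseteq># P}"
      by (simp add: lnB)
  qed
  have "finite {B. B \<subseteq># P}"
  proof (rule finite_subset)
    show "{B. B \<subseteq># P} \<subseteq> (\<Union>n\<le>size P. multisets_of_size (set_mset P) n)"
      by (auto simp: multisets_of_size_def size_mset_mono dest: mset_subset_eqD)
  qed (auto intro: finite_multisets_of_size)
  then show "finite ({..sum_mset P} \<times> {..sum_mset P} \<times> {B. B \<subseteq># P})" by simp
qed

lemma card_Fix_hyperbolic:
  "real (card (Fix P \<sigma>)) = (\<Sum>E\<in>feasible_expressions \<sigma> P. hyperbolic_count \<sigma> f E)"
proof -
  let ?G = "\<lambda>E. {N. set_mset N \<subseteq> index \<and> weight N = 0 \<and> shape N = E}"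
  let ?FE = "feasible_expressions \<sigma> P"
  have G: "finite (?G E) \<and> real (card (?G E)) = hyperbolic_count \<sigma> f E" if "E \<in> ?FE" for E
  proof (cases E)
    case (fields l n B)
    then have "feasible \<sigma> (l, n, B)" using that by (simp add: feasible_expressions_def)
    then show ?thesis using card_shape[OF feasible_bounds] fields by blast
  qed
  have eq: "{N. set_mset N \<subseteq> index \<and> weight N = 0 \<and> shape N \<in> ?FE} = (\<Union>E\<in>?FE. ?G E)"
    by blast
  have "inj_on (tiled orb) (\<Union>E\<in>?FE. ?G E)"
    using bij_betw_imp_inj_on[OF bij_betw_tiled_orb] by (rule inj_on_subset) blast
  then have "card (Fix P \<sigma>) = card (\<Union>E\<in>?FE. ?G E)"
    unfolding Fix_eq eq by (rule card_image)
  also have "\<dots> = (\<Sum>E\<in>?FE. card (?G E))"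
    by (rule card_UN_disjoint) (use G finite_feasible_expressions in blast)+
  finally show ?thesis using G by simp
qed

end

section \<open>Parabolic elements\<close>

locale parabolic_frame = frame v\<^sub>1 v\<^sub>2 for v\<^sub>1 v\<^sub>2 :: "'a::{field,finite}^2" +
  fixes \<sigma> :: "'a^2^2"
  assumes prime_card: "prime (CARD('a))" and odd_card: "odd (CARD('a))"
    and \<sigma>_v1: "\<sigma> *v v\<^sub>1 = v\<^sub>1" and \<sigma>_v2: "\<sigma> *v v\<^sub>2 = v\<^sub>1 + v\<^sub>2"
    and in_class: "\<sigma> \<in> parabolic_class"
begin

text \<open>The key \<open>True\<close> marks the vectors on the eigenline, which are fixed points.\<close>

definition orb :: "bool \<times> 'a \<Rightarrow> ('a^2) set" where
  "orb i = (if fst i then {pt (snd i) 0} else range (\<lambda>a. pt a (snd i)))"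

abbreviation "index \<equiv> Sigma (UNIV :: bool set) (\<lambda>_. - {0::'a})"

abbreviation weight :: "(bool \<times> 'a) multiset \<Rightarrow> 'a" where
  "weight N \<equiv> \<Sum>i\<in>#N. of_bool (fst i) * snd i"

abbreviation load :: "(bool \<times> 'a) multiset \<Rightarrow> bool \<Rightarrow> nat" where
  "load N k \<equiv> size {#i \<in># N. fst i = k#}"

lemma card_ge_3: "CARD('a) \<ge> 3"
  using prime_gt_1_nat[OF prime_card] odd_card by (cases "CARD('a) = 2") auto

lemma \<sigma>_pt: "\<sigma> *v pt a b = pt (a + b) b"
  by (simp add: pt_def vec.add vec.scale \<sigma>_v1 \<sigma>_v2 vec.scale_right_distrib vec.scale_left_distrib)

lemma \<sigma>_pow_pt: "(((*v) \<sigma>) ^^ k) (pt a b) = pt (a + of_nat k * b) b"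
  by (induction k) (simp_all add: \<sigma>_pt algebra_simps)

lemma bij_\<sigma>: "bij ((*v) \<sigma>)"
proof -
  have "inj ((*v) \<sigma>)"
  proof (rule injI)
    fix u v assume "\<sigma> *v u = \<sigma> *v v"
    then show "u = v"
      by (cases u rule: pt_exhaust; cases v rule: pt_exhaust) (auto simp: \<sigma>_pt)
  qed
  then show ?thesis by (simp add: bij_def finite_UNIV_inj_surj)
qed

lemma orb_finite: "finite (orb i)"
  by (rule finite_subset[OF subset_UNIV]) simp

lemma pt_in_orb: "pt a b \<in> orb (k, x) \<longleftrightarrow> (if k then a = x \<and> b = 0 else b = x)"
  by (auto simp: orb_def)

text \<open>Off the eigenline \<open>\<sigma>\<close> translates the first coordinate by
  \<open>x \<noteq> 0\<close>, and the natural multiples of \<open>x\<close> exhaust a prime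
  field.\<close>

lemma orb_range:
  assumes "i \<in> index"
  shows "\<exists>b. orb i = range (\<lambda>k. (((*v) \<sigma>) ^^ k) b)"
proof (cases i)
  case (Pair k x)
  show ?thesis
  proof (cases k)
    case True
    have "orb i = range (\<lambda>k. (((*v) \<sigma>) ^^ k) (pt x 0))"
      unfolding \<sigma>_pow_pt using True Pair by (simp add: orb_def)
    then show ?thesis ..
  next
    case False
    have x: "x \<noteq> 0" using assms Pair by simp
    have "orb i = range (\<lambda>k. pt (of_nat k * x) x)"
    proof (intro equalityI subsetI)
      fix v assume "v \<in> orb i"
      then obtain a where v: "v = pt a x" using False Pair by (auto simp: orb_def)
      have "a / x \<in> of_nat ` {..<CARD('a)}"
        using bij_betw_imp_surj_on[OF bij_of_nat_prime_field[OF prime_card]] by simp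
      then obtain k where "a / x = of_nat k" by blast
      then have "v = pt (of_nat k * x) x" using v x by (simp add: field_simps)
      then show "v \<in> range (\<lambda>k. pt (of_nat k * x) x)" by blast
    qed (use False Pair in \<open>auto simp: orb_def\<close>)
    then have "orb i = range (\<lambda>k. (((*v) \<sigma>) ^^ k) (pt 0 x))"
      by (simp add: \<sigma>_pow_pt)
    then show ?thesis ..
  qed
qed

lemma Union_orb: "(\<Union>i\<in>index. orb i) = - {0}"
proof (intro equalityI subsetI)
  fix v assume "v \<in> (\<Union>i\<in>index. orb i)"
  then obtain k x where i: "x \<noteq> 0" "v \<in> orb (k, x)" by auto
  obtain a b where "v = pt a b" by (rule pt_exhaust)
  then show "v \<in> - {0}" using i pt_in_orb[of a b k x] by (auto split: if_splits)
next
  fix v :: "'a^2" assume v: "v \<in> - {0}"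
  obtain a b where ab: "v = pt a b" by (rule pt_exhaust)
  show "v \<in> (\<Union>i\<in>index. orb i)"
  proof (cases "b = 0")
    case True
    then have "v \<in> orb (True, a)" "a \<noteq> 0" using v ab by (auto simp: pt_in_orb)
    then show ?thesis by (intro UN_I[of "(True, a)"]) auto
  next
    case False
    then have "v \<in> orb (False, b)" using ab by (simp add: pt_in_orb)
    then show ?thesis using False by (intro UN_I[of "(False, b)"]) auto
  qed
qed

lemma disjoint_orb: "disjoint_family_on orb index"
  unfolding disjoint_family_on_def
proof (intro ballI impI)
  fix i j assume ij: "i \<in> index" "j \<in> index" "i \<noteq> j"
  show "orb i \<inter> orb j = {}"
  proof (intro equalityI subsetI)
    fix v assume v: "v \<in> orb i \<inter> orb j"
    obtain a b where "v = pt a b" by (rule pt_exhaust)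
    then show "v \<in> {}"
      using v ij by (cases i; cases j) (auto simp: pt_in_orb split: if_splits)
  qed simp
qed

lemma bij_betw_tiled_orb:
  "bij_betw (tiled orb) {N. set_mset N \<subseteq> index} {M. 0 \<notin># M \<and> image_mset ((*v) \<sigma>) M = M}"
proof -
  have "finite index" by simp
  have "bij_betw (tiled orb) {N. set_mset N \<subseteq> index}
     {M. set_mset M \<subseteq> (\<Union>i\<in>index. orb i) \<and> image_mset ((*v) \<sigma>) M = M}"
  proof (rule bij_betw_tiled[OF bij_\<sigma> \<open>finite index\<close> orb_finite disjoint_orb orb_range])
    fix v assume "\<sigma> *v v \<in> (\<Union>i\<in>index. orb i)"
    then show "v \<in> (\<Union>i\<in>index. orb i)" unfolding Union_orb by auto
  qed
  then show ?thesis unfolding Union_orb by auto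
qed

text \<open>Negation permutes the field, so twice the sum is 0; 2 is invertible because
  \<open>p\<close> is odd.\<close>

lemma sum_field: "(\<Sum>a\<in>UNIV. a :: 'a) = 0"
proof -
  let ?S = "\<Sum>a\<in>UNIV. a :: 'a"
  have "?S = (\<Sum>a\<in>UNIV. - a)"
    by (rule sum.reindex_bij_witness[of _ uminus uminus]) auto
  also have "\<dots> = - ?S" by (rule sum_negf)
  finally have "?S + ?S = ?S + - ?S" by (rule arg_cong)
  then have "2 * ?S = 0" by (simp only: mult_2 add.right_inverse)
  moreover have "(2::'a) \<noteq> 0"
  proof
    assume "(2::'a) = 0"
    then have "of_nat 2 = (0::'a)" by simp
    then have "CARD('a) dvd 2"
      by (simp only: of_nat_eq_0_iff_char_dvd CHAR_prime_card[OF prime_card])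
    then show False using card_ge_3 by (auto dest: dvd_imp_le)
  qed
  ultimately show ?thesis by simp
qed

lemma sum_orb: "\<Sum>(orb i) = pt (of_bool (fst i) * snd i) 0"
proof (cases "fst i")
  case False
  have "\<Sum>(orb i) = (\<Sum>a\<in>UNIV. pt a (snd i))"
    using False by (simp add: orb_def sum.reindex inj_on_def)
  also have "\<dots> = pt 0 (of_nat CARD('a) * snd i)"
    by (simp add: sum_pt sum_field)
  also have "of_nat CARD('a) = (0::'a)"
    by (simp add: of_nat_eq_0_iff_char_dvd CHAR_prime_card[OF prime_card])
  finally show ?thesis using False by simp
qed (simp add: orb_def)

lemma sum_mset_tiled_orb: "sum_mset (tiled orb N) = pt (weight N) 0"
  by (simp add: sum_mset_tiled sum_orb sum_mset_pt)

lemma card_orb_line: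
  assumes "i \<in> index"
  shows "card {v \<in> orb i. v \<in> line (Some 0)} = (if fst i = True then 1 else 0)"
    "k \<noteq> Some 0 \<Longrightarrow> card {v \<in> orb i. v \<in> line k} = (if fst i = False then 1 else 0)"
proof -
  obtain h x where i: "i = (h, x)" and x: "x \<noteq> 0" using assms by auto
  show "card {v \<in> orb i. v \<in> line (Some 0)} = (if fst i = True then 1 else 0)"
  proof (cases h)
    case True
    then have "{v \<in> orb i. v \<in> line (Some 0)} = {pt x 0}" using i by (auto simp: orb_def)
    then show ?thesis using True i by simp
  next
    case False
    then have "{v \<in> orb i. v \<in> line (Some 0)} = {}" using i x by (auto simp: orb_def)
    then show ?thesis using False i by (simp only: card.empty) simp
  qed
  assume k: "k \<noteq> Some 0"
  show "card {v \<in> orb i. v \<in> line k} = (if fst i = False then 1 else 0)"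
  proof (cases h)
    case True
    then have "{v \<in> orb i. v \<in> line k} = {}" using i x k by (cases k) (auto simp: orb_def)
    then show ?thesis using True i by (simp only: card.empty) simp
  next
    case False
    \<comment> \<open>The orbit contains every vector with second coordinate \<open>x\<close>; on
      the line of slope \<open>t \<noteq> 0\<close> the first coordinate must then be
      \<open>x / t\<close>.\<close>
    then have "{v \<in> orb i. v \<in> line k} = {pt (case k of None \<Rightarrow> 0 | Some t \<Rightarrow> x / t) x}"
      using i x k by (cases k) (auto simp: orb_def)
    then show ?thesis using False i by simp
  qed
qed

lemma on_line_tiled_orb:
  assumes "set_mset N \<subseteq> index"
  shows "on_line (tiled orb N) k = load N (k = Some 0)"
proof -
  have *: "on_line (tiled orb N) k = load N k'"
    if "\<And>i. i \<in> index \<Longrightarrow> card {v \<in> orb i. v \<in> line k} = (if fst i = k' then 1 else 0)" for k'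
  proof -
    have "on_line (tiled orb N) k = (\<Sum>i\<in>#N. card {v \<in> orb i. v \<in> line k})"
      by (rule size_filter_tiled) (simp add: orb_finite)
    also have "\<dots> = (\<Sum>i\<in>#N. if fst i = k' then 1 else 0)"
      using assms that by (intro arg_cong[where f = sum_mset] image_mset_cong) blast
    finally show ?thesis using sum_mset_if_eq[of k' 1 N] by simp
  qed
  show ?thesis
  proof (cases "k = Some 0")
    case True
    have "on_line (tiled orb N) k = load N True"
      by (rule *) (simp only: True card_orb_line(1))
    then show ?thesis using True by simp
  next
    case False
    have "on_line (tiled orb N) k = load N False"
      by (rule *) (simp only: card_orb_line(2)[OF _ False])
    then show ?thesis using False by simp
  qed
qed

definition type_of :: "nat \<Rightarrow> nat \<Rightarrow> nat multiset" where
  "type_of l q = filter_mset (\<lambda>k. k \<noteq> 0) (add_mset l (replicate_mset (CARD('a)) q))"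

lemma partition_type_tiled_orb:
  assumes "set_mset N \<subseteq> index"
  shows "partition_type (tiled orb N) = type_of (load N True) (load N False)"
proof -
  have "mset_set UNIV = add_mset (Some 0) (mset_set (UNIV - {Some (0::'a)}))"
    by (rule mset_set.remove) auto
  moreover have "image_mset (\<lambda>k. load N (k = Some 0)) (mset_set (UNIV - {Some (0::'a)})) =
      image_mset (\<lambda>_. load N False) (mset_set (UNIV - {Some (0::'a)}))"
    by (rule image_mset_cong) simp
  moreover have "size (mset_set (UNIV - {Some (0::'a)})) = CARD('a)"
    by (simp add: card_Diff_subset card_UNIV_option)
  ultimately show ?thesis
    by (simp add: partition_type_eq on_line_tiled_orb[OF assms] type_of_def image_mset_const_eq)
qed

text \<open>A positive \<open>q'\<close> occurs at least \<open>p \<ge> 3\<close> times in its type,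
  but at most once in a type whose repeated part is different. So here, unlike in the hyperbolic
  case, the expression is determined by the partition.\<close>

lemma type_of_inject:
  assumes "type_of l q = type_of l' q'" "q' > 0"
  shows "l = l' \<and> q = q'"
proof -
  have count: "count (type_of l q) a =
      (if a = 0 then 0 else (if a = l then 1 else 0) + (if a = q then CARD('a) else 0))" for l q a
    by (auto simp: type_of_def)
  have c: "count (type_of l q) a = count (type_of l' q') a" for a
    using assms by simp
  have q: "q = q'"
  proof (rule ccontr)
    assume "q \<noteq> q'"
    then show False
      using c[of q'] assms(2) card_ge_3 by (auto simp: count split: if_splits)
  qed
  have "l = l'"
  proof (cases "l = 0")
    case True
    then show ?thesis using c[of l'] q by (auto simp: count split: if_splits)
  next
    case False
    then show ?thesis using c[of l] q by (auto simp: count split: if_splits)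
  qed
  then show ?thesis using q by simp
qed

lemma Fix_eq:
  assumes "q > 0"
  shows "Fix (type_of l q) \<sigma> = tiled orb `
    {N \<in> families UNIV (\<lambda>_. - {0}) (\<lambda>k. if k then l else q). weight N = 0}" (is "_ = _ ` ?S")
proof -
  have p: "CARD('a) \<ge> 3" by (rule card_ge_3)
  have "filter_mset (\<lambda>k. k \<noteq> 0) (replicate_mset (CARD('a)) q) = replicate_mset (CARD('a)) q"
    using assms by (auto simp: filter_mset_eq_conv)
  then have type: "type_of l q = (if l = 0 then {#} else {#l#}) + replicate_mset (CARD('a)) q"
    by (simp add: type_of_def)
  have "size (type_of l q) \<ge> CARD('a)"
    by (simp add: type)
  moreover have "sum_mset (type_of l q) \<ge> CARD('a) * q"
    by (simp add: type)
  moreover have "CARD('a) * q \<ge> CARD('a)" using assms by simp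
  \<comment> \<open>The \<open>p \<ge> 3\<close> positive parts equal to \<open>q\<close> already
    settle spanning and size.\<close>
  ultimately have large: "size (type_of l q) \<ge> 2" "sum_mset (type_of l q) \<ge> 3"
    using p by linarith+
  have iff: "tiled orb N \<in> Fix (type_of l q) \<sigma> \<longleftrightarrow> N \<in> ?S" if N: "set_mset N \<subseteq> index" for N
  proof -
    have inv: "0 \<notin># tiled orb N" "image_mset ((*v) \<sigma>) (tiled orb N) = tiled orb N"
      using bij_betw_apply[OF bij_betw_tiled_orb, of N] N by auto
    have "sum_mset (tiled orb N) = 0 \<longleftrightarrow> weight N = 0"
      by (simp only: sum_mset_tiled_orb pt_eq_0_iff simp_thms)
    then have "tiled orb N \<in> Fix (type_of l q) \<sigma> \<longleftrightarrow> weight N = 0 \<and>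
        type_of (load N True) (load N False) = type_of l q"
      using inv large by (simp only: Fix_def multisets_of_type_def mem_Collect_eq
          zero_sum_multiset_iff[OF inv(1)] partition_type_tiled_orb[OF N]) auto
    also have "type_of (load N True) (load N False) = type_of l q \<longleftrightarrow> load N True = l \<and> load N False = q"
      using type_of_inject[OF _ assms] by blast
    finally show ?thesis
      using N by (auto simp: families_def UNIV_bool)
  qed
  show ?thesis
  proof (intro equalityI subsetI)
    fix M assume M: "M \<in> Fix (type_of l q) \<sigma>"
    then have "0 \<notin># M" "image_mset ((*v) \<sigma>) M = M"
      by (auto simp: Fix_def multisets_of_type_def zero_sum_multiset_def)
    then obtain N where "set_mset N \<subseteq> index" "M = tiled orb N"
      using bij_betw_imp_surj_on[OF bij_betw_tiled_orb] by (metis (mono_tags, lifting) imageE mem_Collect_eq)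
    then show "M \<in> tiled orb ` ?S" using iff M by blast
  next
    fix M assume "M \<in> tiled orb ` ?S"
    then obtain N where N: "N \<in> ?S" "M = tiled orb N" by blast
    then have "set_mset N \<subseteq> index" by (simp add: families_def)
    then show "M \<in> Fix (type_of l q) \<sigma>" using iff N by blast
  qed
qed

lemma expr_partition_eq: "expr_partition \<sigma> (l, 0, {#q#}) = type_of l q"
proof -
  have "central_indicator \<sigma> = CARD('a)" "central_quotient \<sigma> = 1"
    using in_class by (auto simp: parabolic_class_def)
  then show ?thesis by (simp add: expr_partition_def type_of_def)
qed

text \<open>Orbits off the eigenline sum to 0, so the key \<open>False\<close> is free, with
  \<open>p - 1\<close> labels; the equation involves the eigenline alone.\<close>

lemma card_Fix_parabolic:
  assumes "q > 0"
  shows "real (card (Fix (expr_partition \<sigma> (l, 0, {#q#})) \<sigma>)) =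
    real ((q + CARD('a) - 2) choose q) * W_num (CARD('a)) {#l#}"
proof -
  let ?s = "\<lambda>k. if k then l else q"
  let ?S = "{N \<in> families UNIV (\<lambda>_. - {0::'a}) ?s. weight N = 0}"
  have "inj_on (tiled orb) ?S"
    using bij_betw_imp_inj_on[OF bij_betw_tiled_orb] by (rule inj_on_subset) (auto simp: families_def)
  then have "card (Fix (expr_partition \<sigma> (l, 0, {#q#})) \<sigma>) = card ?S"
    unfolding expr_partition_eq Fix_eq[OF assms] by (rule card_image)
  also have "real \<dots> = (\<Prod>k\<in>UNIV - {True}. real ((card (- {0::'a}) + ?s k - 1) choose ?s k)) *
      W_num (CARD('a)) (image_mset ?s (mset_set {True}))"
    by (rule card_families_zero_sum[OF prime_card]) auto
  also have "UNIV - {True} = {False}" by auto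
  also have "(\<Prod>k\<in>{False}. real ((card (- {0::'a}) + ?s k - 1) choose ?s k)) =
      real ((q + CARD('a) - 2) choose q)"
  proof -
    have "card (- {0::'a}) + q - 1 = q + CARD('a) - 2"
      using card_ge_3 by (simp add: Compl_eq_Diff_UNIV card_Diff_subset)
    then show ?thesis by simp
  qed
  finally show ?thesis by simp
qed

end

section \<open>The counting formula\<close>

lemma size_blocks: "size (blocks u \<pi> m) = (\<Sum>i=1..u. m i)"
proof -
  have "size (\<Sum>i\<in>A. replicate_mset (m i) (\<pi> i)) = sum m A" for A
    by (induction A rule: infinite_finite_induct) simp_all
  then show ?thesis by (simp add: blocks_def)
qed

lemma
  assumes "\<forall>i\<in>{1..u}. m i \<ge> 1" and inj: "inj_on \<pi> {1..u}"
  shows set_mset_blocks: "set_mset (blocks u \<pi> m) = \<pi> ` {1..u}"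
    and count_blocks: "i \<in> {1..u} \<Longrightarrow> count (blocks u \<pi> m) (\<pi> i) = m i"
proof -
  show "set_mset (blocks u \<pi> m) = \<pi> ` {1..u}"
    using assms(1) by (force simp: blocks_def set_mset_sum)
  assume i: "i \<in> {1..u}"
  have "count (blocks u \<pi> m) (\<pi> i) = (\<Sum>j\<in>{1..u}. if j = i then m j else 0)"
    unfolding blocks_def count_sum
  proof (rule sum.cong)
    fix j assume j: "j \<in> {1..u}"
    show "count (replicate_mset (m j) (\<pi> j)) (\<pi> i) = (if j = i then m j else 0)"
      using inj_on_eq_iff[OF inj j i] by auto
  qed simp
  then show "count (blocks u \<pi> m) (\<pi> i) = m i"
    using i by simp
qed

text \<open>Distinctness of the \<open>\<pi> i\<close> identifies the multiplicities in the multiset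
  with the \<open>m i\<close>.\<close>

lemma O_num_blocks:
  fixes \<sigma> :: "('a::{field,finite})^2^2"
  assumes "\<forall>i\<in>{1..u}. m i \<ge> 1" and "inj_on \<pi> {1..u}"
  shows "O_num \<sigma> (blocks u \<pi> m) =
    fact (o_num \<sigma>) / (fact (o_num \<sigma> - (\<Sum>i=1..u. m i)) * (\<Prod>i=1..u. fact (m i)))"
proof -
  have "(\<Prod>q\<in>set_mset (blocks u \<pi> m). fact (count (blocks u \<pi> m) q) :: real) =
      (\<Prod>i=1..u. fact (count (blocks u \<pi> m) (\<pi> i)))"
    unfolding set_mset_blocks[OF assms] using assms(2) by (simp add: prod.reindex)
  also have "\<dots> = (\<Prod>i=1..u. fact (m i))"
    by (rule prod.cong) (simp_all add: count_blocks[OF assms])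
  finally show ?thesis by (simp add: O_num_def size_blocks)
qed

lemma blocks_size_1:
  assumes "\<forall>i\<in>{1..u}. m i \<ge> 1" and "size (blocks u \<pi> m) = 1"
  shows "u = 1" "blocks u \<pi> m = {#\<pi> 1#}"
proof -
  have sum1: "(\<Sum>i=1..u. m i) = 1" using assms(2) by (simp add: size_blocks)
  moreover have "(\<Sum>i=1..u. 1) \<le> (\<Sum>i=1..u. m i)"
    by (rule sum_mono) (use assms(1) in auto)
  moreover have "u \<noteq> 0" using sum1 by (intro notI) simp
  ultimately show u: "u = 1" by simp
  then show "blocks u \<pi> m = {#\<pi> 1#}" using sum1 by (simp add: blocks_def)
qed

section \<open>Bases adapted to \<open>\<sigma>\<close> and the final count\<close>

lemma hyperbolic_frame_exists:
  fixes \<sigma> :: "('a::{field,finite})^2^2"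
  assumes "prime (CARD('a))" and \<sigma>: "\<sigma> \<in> hyperbolic_class f"
  obtains v\<^sub>1 v\<^sub>2 y where "hyperbolic_frame v\<^sub>1 v\<^sub>2 \<sigma> y f"
proof -
  from \<sigma> obtain y where ev: "{c. eigenvalue \<sigma> c} = {1, y}" and f: "mult_order y = f" "f > 1"
      and inv: "invertible \<sigma>"
    by (auto simp: hyperbolic_class_def)
  have "eigenvalue \<sigma> 1" "eigenvalue \<sigma> y" using ev by auto
  then obtain v\<^sub>1 v\<^sub>2 where v1: "v\<^sub>1 \<noteq> 0" "\<sigma> *v v\<^sub>1 = v\<^sub>1" and v2: "v\<^sub>2 \<noteq> 0" "\<sigma> *v v\<^sub>2 = y *s v\<^sub>2"
    by (auto simp: eigenvalue_def eigenspace_def)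
  have y1: "y \<noteq> 1" using f by auto
  have y0: "y \<noteq> 0"
  proof
    assume "y = 0"
    then have "\<sigma> *v v\<^sub>2 = 0" using v2 by simp
    moreover obtain \<tau> where "\<tau> ** \<sigma> = mat 1" using inv by (auto simp: invertible_def)
    ultimately have "v\<^sub>2 = 0"
      by (metis matrix_vector_mul_assoc matrix_vector_mul_lid matrix_vector_mult_0_right)
    then show False using v2 by simp
  qed
  have "hyperbolic_frame v\<^sub>1 v\<^sub>2 \<sigma> y f"
  proof
    fix a b assume eq: "a *s v\<^sub>1 + b *s v\<^sub>2 = 0"
    \<comment> \<open>Applying \<open>\<sigma>\<close> scales only the second term; the difference
      isolates \<open>b * (y - 1)\<close>.\<close>
    then have "\<sigma> *v (a *s v\<^sub>1 + b *s v\<^sub>2) = 0" by simp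
    then have "a *s v\<^sub>1 + (b * y) *s v\<^sub>2 = 0"
      by (simp add: vec.add vec.scale v1 v2 vec.scale_scale)
    then have "(b * y) *s v\<^sub>2 = b *s v\<^sub>2" using eq by (metis add_left_cancel)
    then have "(b * y - b) *s v\<^sub>2 = 0" by (simp add: vec.scale_left_diff_distrib)
    then have "b * (y - 1) = 0" using v2 by (simp add: algebra_simps)
    then have "b = 0" using y1 by simp
    then show "a = 0 \<and> b = 0" using eq v1 by simp
  next
    have "eigenvalue \<sigma> c \<and> c \<noteq> 1 \<longleftrightarrow> c = y" for c
      using ev y1 by (metis insertCI insertE mem_Collect_eq singletonD)
    then show "other_order \<sigma> = f" by (simp add: other_order_def f)
  qed (use assms v1 v2 y0 f in simp_all)
  then show ?thesis by (rule that)
qed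

text \<open>For \<open>w\<close> off the eigenline write
  \<open>\<sigma> *v w = a *s v + b *s w\<close>. Having 1 as the only eigenvalue forces
  \<open>b = 1\<close>, not being scalar forces \<open>a \<noteq> 0\<close>, and dividing
  \<open>w\<close> by \<open>a\<close> normalises the matrix.\<close>

lemma parabolic_frame_exists:
  fixes \<sigma> :: "('a::{field,finite})^2^2"
  assumes "prime (CARD('a))" "odd (CARD('a))" and \<sigma>: "\<sigma> \<in> parabolic_class"
  obtains v\<^sub>1 v\<^sub>2 where "parabolic_frame v\<^sub>1 v\<^sub>2 \<sigma>"
proof -
  from \<sigma> have ev: "\<And>c. eigenvalue \<sigma> c \<longleftrightarrow> c = 1" and inv: "invertible \<sigma>" and ns: "\<not> is_scalar \<sigma>"
    by (auto simp: parabolic_class_def parabolic_def)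
  have "eigenvalue \<sigma> 1" using ev by simp
  then obtain v where v: "v \<noteq> 0" "\<sigma> *v v = v"
    by (auto simp: eigenvalue_def eigenspace_def)
  have "vec.dim (vec.span {v}) = 1" (is "?d = 1")
    using v vec.dim_eq_card_independent[of "{v}"] by (simp add: vec.dim_span)
  moreover have "vec.dim (UNIV :: ('a^2) set) = 2"
    by (simp add: vec_dim_card card_cart_basis)
  ultimately have "?d \<noteq> vec.dim (UNIV :: ('a^2) set)" by simp
  then have "vec.span {v} \<noteq> UNIV" by metis
  then obtain w where w: "w \<notin> vec.span {v}" by blast
  have fr: "frame v w"
  proof
    fix a b assume eq: "a *s v + b *s w = 0"
    have "b = 0"
    proof (rule ccontr)
      assume b: "b \<noteq> 0"
      have "b *s w = (- a) *s v"
        using eq by (simp add: eq_neg_iff_add_eq_0 add.commute)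
      then have "inverse b *s (b *s w) = inverse b *s ((- a) *s v)" by simp
      then have "w = (inverse b * (- a)) *s v" using b by (simp add: vec.scale_scale)
      then show False using w by (metis vec.span_base vec.span_scale singletonI)
    qed
    then show "a = 0 \<and> b = 0" using eq v by simp
  qed
  interpret frame v w by (rule fr)
  obtain a b where ab: "\<sigma> *v w = pt a b" by (rule pt_exhaust)
  have \<sigma>_pt: "\<sigma> *v pt c d = pt (c + d * a) (d * b)" for c d
  proof -
    have "\<sigma> *v pt c d = c *s v + d *s pt a b"
      by (simp add: pt_def[of c d] vec.add vec.scale v ab)
    also have "\<dots> = pt c 0 + pt (d * a) (d * b)" by (simp add: pt_scale) (simp add: pt_def)
    finally show ?thesis by (simp add: pt_add)
  qed
  have b: "b = 1"
  proof (rule ccontr)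
    assume b: "b \<noteq> 1"
    \<comment> \<open>With second coordinate 1, an eigenvector for \<open>b\<close> needs a first
      coordinate \<open>c\<close> with \<open>c + a = b * c\<close>.\<close>
    have "\<sigma> *v pt (a / (b - 1)) 1 = b *s pt (a / (b - 1)) 1"
      using b by (simp add: \<sigma>_pt pt_scale field_simps)
    moreover have "pt (a / (b - 1)) 1 \<noteq> 0" by simp
    ultimately have "eigenvalue \<sigma> b" unfolding eigenvalue_def eigenspace_def by blast
    then show False using ev b by simp
  qed
  have a: "a \<noteq> 0"
  proof
    assume "a = 0"
    then have "\<sigma> *v u = mat 1 *v u" for u
      by (cases u rule: pt_exhaust) (simp add: \<sigma>_pt b)
    then have "\<sigma> = mat 1" by (simp add: matrix_eq)
    then show False using ns by (auto simp: is_scalar_def)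
  qed
  have "parabolic_frame v (pt 0 (inverse a)) \<sigma>"
  proof
    fix c d assume "c *s v + d *s pt 0 (inverse a) = 0"
    moreover have "c *s v = pt c 0" by (simp add: pt_def)
    ultimately have "pt c (d * inverse a) = 0" by (simp add: pt_scale pt_add)
    then show "c = 0 \<and> d = 0" using a by simp
  next
    have v_pt: "pt 1 0 = v" by (simp add: pt_def)
    have "\<sigma> *v pt 0 (inverse a) = pt 1 0 + pt 0 (inverse a)"
      using a by (simp add: \<sigma>_pt b pt_add)
    then show "\<sigma> *v pt 0 (inverse a) = v + pt 0 (inverse a)"
      by (simp only: v_pt)
  qed (use assms v in simp_all)
  then show ?thesis by (rule that)
qed

theorem theorem5:
  fixes \<sigma> :: "('a::{field,finite})^2^2"
    and p f l n u :: nat and \<pi> m :: "nat \<Rightarrow> nat" and P :: "nat multiset"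
  assumes "prime p" and "odd p" and "CARD('a) = p"
    and "invertible \<sigma>" and "eigenvalue \<sigma> 1"
    and "\<forall>i\<in>{1..u}. \<pi> i \<ge> 1 \<and> m i \<ge> 1" and "inj_on \<pi> {1..u}"
    and "P = expr_partition \<sigma> (l, n, blocks u \<pi> m)"
    and "feasible \<sigma> (l, n, blocks u \<pi> m)"
  shows
    "(\<sigma> \<in> hyperbolic_class f \<longrightarrow>
        real (card (Fix P \<sigma>)) = (\<Sum>E\<in>feasible_expressions \<sigma> P. hyperbolic_count \<sigma> f E)) \<and>
     (\<sigma> \<in> hyperbolic_class f \<and> feasible_expressions \<sigma> P = {(l, n, blocks u \<pi> m)} \<longrightarrow>
        real (card (Fix P \<sigma>)) =
          fact (o_num \<sigma>) / (fact (o_num \<sigma> - (\<Sum>i=1..u. m i)) * (\<Prod>i=1..u. fact (m i))) *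
          real ((n + (p - 1) div f - 1) choose n) *
          W_num p (add_mset l (blocks u \<pi> m))) \<and>
     (\<sigma> \<in> parabolic_class \<longrightarrow>
        real (card (Fix P \<sigma>)) = real ((\<pi> 1 + p - 2) choose \<pi> 1) * W_num p {#l#})"
proof (intro conjI impI; (elim conjE)?)
  have p: "prime (CARD('a))" "odd (CARD('a))" using assms(1-3) by simp_all
  have hyperbolic: "real (card (Fix P \<sigma>)) = (\<Sum>E\<in>feasible_expressions \<sigma> P. hyperbolic_count \<sigma> f E)"
    if \<sigma>: "\<sigma> \<in> hyperbolic_class f"
  proof -
    obtain v\<^sub>1 v\<^sub>2 y where "hyperbolic_frame v\<^sub>1 v\<^sub>2 \<sigma> y f"
      using hyperbolic_frame_exists[OF p(1) \<sigma>] .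
    then show ?thesis by (rule hyperbolic_frame.card_Fix_hyperbolic)
  qed
  then show "real (card (Fix P \<sigma>)) = (\<Sum>E\<in>feasible_expressions \<sigma> P. hyperbolic_count \<sigma> f E)"
    if "\<sigma> \<in> hyperbolic_class f" using that .
  have m: "\<forall>i\<in>{1..u}. m i \<ge> 1" using assms(6) by blast
  show "real (card (Fix P \<sigma>)) =
      fact (o_num \<sigma>) / (fact (o_num \<sigma> - (\<Sum>i=1..u. m i)) * (\<Prod>i=1..u. fact (m i))) *
      real ((n + (p - 1) div f - 1) choose n) * W_num p (add_mset l (blocks u \<pi> m))"
    if "\<sigma> \<in> hyperbolic_class f" "feasible_expressions \<sigma> P = {(l, n, blocks u \<pi> m)}"
    unfolding hyperbolic[OF that(1)] that(2)
    by (simp add: hyperbolic_count_def O_num_blocks[OF m assms(7)] assms(3))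
  show "real (card (Fix P \<sigma>)) = real ((\<pi> 1 + p - 2) choose \<pi> 1) * W_num p {#l#}"
    if \<sigma>: "\<sigma> \<in> parabolic_class"
  proof -
    obtain v\<^sub>1 v\<^sub>2 where frame: "parabolic_frame v\<^sub>1 v\<^sub>2 \<sigma>"
      using parabolic_frame_exists[OF p \<sigma>] .
    have "n = 0" "size (blocks u \<pi> m) = 1"
      using assms(9) \<sigma> by (auto simp: feasible_def parabolic_class_def)
    moreover from this have "u = 1"
      using blocks_size_1(1)[OF m] by blast
    then have "\<pi> 1 > 0"
      using assms(6) by auto
    ultimately show ?thesis
      using parabolic_frame.card_Fix_parabolic[OF frame, of "\<pi> 1" l] blocks_size_1(2)[OF m]
      by (simp add: assms(3,8))
  qed
qed

end
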